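(* For every $\theta>0$ there exist positive integers $Q=Q(\theta)$ and $R=R(\theta)$, and for every sufficiently large $N$ (depending only on $\theta$) there exists a kernel $\phi_{N,\theta}$ on $\mathbb{Z}_{\widetilde N}$, such that for every $\chi\in\mathcal{M}$, writing $\chi_{N,s}=\chi_N*\phi_{N,\theta}$ and $\chi_{N,u}=\chi_N-\chi_{N,s}$, we have: (i) $|\chi_{N,s}(n+Q)-\chi_{N,s}(n)|\le R/\widetilde N$ for every $n\in\mathbb{Z}_{\widetilde N}$ (with $n+Q$ taken mod $\widetilde N$); (ii) $\|\chi_{N,u}\|_{U^2(\mathbb{Z}_{\widetilde N})}\le\theta$. Moreover, for all $0<\theta'\le\theta$ and every $N$ for which both $\phi_{N,\theta}$ and $\phi_{N,\theta'}$ are defined, $\widehat{\phi_{N,\theta'}}(\xi)\ge\widehat{\phi_{N,\theta}}(\xi)\ge 0$ for every $\xi\in\mathbb{Z}_{\widetilde N}$.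
   Context: Fixed positive integers $\ell_1,\ell_2,\ell_3$, $\ell=\ell_1+\ell_2+\ell_3$; $\widetilde N$ is the smallest prime greater than $10\ell N$. $\mathcal{M}$: completely multiplicative $\chi:\mathbb{N}\to\mathbb{C}$ with $|\chi|=1$. $\chi_N$ on $\mathbb{Z}_{\widetilde N}\cong\{1,\dots,\widetilde N\}$: $\chi_N(n)=\chi(n)$ for $1\le n\le N$, else $0$. A kernel is a non-negative function on $\mathbb{Z}_{\widetilde N}$ with average $1$; $(f*\psi)(n)=\mathbb{E}_{k\in\mathbb{Z}_{\widetilde N}}\psi(n-k)f(k)$; $\widehat f(\xi)=\mathbb{E}_{n\in\mathbb{Z}_{\widetilde N}}f(n)e(-n\xi/\widetilde N)$ with $e(x)=\exp(2\pi i x)$; $\|f\|_{U^2(\mathbb{Z}_M)}^4=\mathbb{E}_{h}|\mathbb{E}_n f(n+h)\overline f(n)|^2$. *)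

theory Defs
  imports
    Complex_Main
    "HOL-Computational_Algebra.Primes"
    "HOL-Library.Complex_Order"
begin

text \<open>
  The modulus \<open>M\<close> varies inside the statements, so a function on \<open>\<int>/M\<int>\<close> is represented by an
  \<open>M\<close>-periodic function on \<^typ>\<open>int\<close>, and a statement about all elements of \<open>\<int>/M\<int>\<close> by one about
  all integers.
\<close>

definition periodic_mod :: "nat \<Rightarrow> (int \<Rightarrow> 'a) \<Rightarrow> bool" where
  "periodic_mod M f \<longleftrightarrow> (\<forall>n. f (n + int M) = f n)"

definition zmod_avg :: "nat \<Rightarrow> (int \<Rightarrow> 'a::field_char_0) \<Rightarrow> 'a" where
  "zmod_avg M f = (\<Sum>n\<in>{1..int M}. f n) / of_nat M"

definition e_char :: "real \<Rightarrow> complex" where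
  "e_char x = exp (2 * of_real pi * \<i> * of_real x)"

definition zmod_fourier :: "nat \<Rightarrow> (int \<Rightarrow> complex) \<Rightarrow> int \<Rightarrow> complex" where
  "zmod_fourier M f \<xi> =
     zmod_avg M (\<lambda>n. f n * e_char (- (of_int n * of_int \<xi> / of_nat M)))"

definition zmod_conv :: "nat \<Rightarrow> (int \<Rightarrow> complex) \<Rightarrow> (int \<Rightarrow> complex) \<Rightarrow> int \<Rightarrow> complex" where
  "zmod_conv M f \<psi> n = zmod_avg M (\<lambda>k. \<psi> (n - k) * f k)"

definition U2_norm :: "nat \<Rightarrow> (int \<Rightarrow> complex) \<Rightarrow> real" where
  "U2_norm M f =
     root 4 (zmod_avg M (\<lambda>h. (cmod (zmod_avg M (\<lambda>n. f (n + h) * cnj (f n))))\<^sup>2))"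

definition zmod_kernel :: "nat \<Rightarrow> (int \<Rightarrow> real) \<Rightarrow> bool" where
  "zmod_kernel M \<phi> \<longleftrightarrow> periodic_mod M \<phi> \<and> (\<forall>n. 0 \<le> \<phi> n) \<and> zmod_avg M \<phi> = 1"

definition N_tilde :: "nat \<Rightarrow> nat \<Rightarrow> nat" where
  "N_tilde l N = (LEAST p. prime p \<and> 10 * l * N < p)"

text \<open>
  The domain of a multiplicative function is the set of positive integers; the value \<open>chi 0\<close> is
  unconstrained and is never used.
\<close>

definition unimodular_cmult :: "(nat \<Rightarrow> complex) set" where
  "unimodular_cmult =
     {chi. (\<forall>m\<ge>1. \<forall>n\<ge>1. chi (m * n) = chi m * chi n) \<and> (\<forall>n\<ge>1. cmod (chi n) = 1)}"

text \<open>
  The representative of \<open>n\<close> is taken in \<open>{0..<M}\<close> instead of \<open>{1..M}\<close>; for \<open>N < M\<close> this makes no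
  difference, since the classes of \<open>0\<close> and \<open>M\<close> both receive the value \<open>0\<close>.
\<close>

definition truncate_mod :: "nat \<Rightarrow> nat \<Rightarrow> (nat \<Rightarrow> complex) \<Rightarrow> int \<Rightarrow> complex" where
  "truncate_mod M N chi n =
     (let r = nat (n mod int M) in if 1 \<le> r \<and> r \<le> N then chi r else 0)"

definition structured_part ::
    "nat \<Rightarrow> nat \<Rightarrow> (int \<Rightarrow> real) \<Rightarrow> (nat \<Rightarrow> complex) \<Rightarrow> int \<Rightarrow> complex" where
  "structured_part M N \<phi> chi = zmod_conv M (truncate_mod M N chi) (\<lambda>n. complex_of_real (\<phi> n))"

definition uniform_part ::
    "nat \<Rightarrow> nat \<Rightarrow> (int \<Rightarrow> real) \<Rightarrow> (nat \<Rightarrow> complex) \<Rightarrow> int \<Rightarrow> complex" where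
  "uniform_part M N \<phi> chi n = truncate_mod M N chi n - structured_part M N \<phi> chi n"

end

theory Submission
  imports
    Defs
    "HOL-Analysis.Analysis"
    "HOL-Computational_Algebra.Squarefree"
    "HOL-Number_Theory.Cong"
begin

text \<open>
  The uniform input is Daboussi's theorem in the quantitative form given by Katai's argument: if
  \<open>P\<close> is a finite set of primes and \<open>A\<close> is the sum of their reciprocals, then by Turan-Kubilius the
  number of prime divisors of \<open>n\<close> in \<open>P\<close> is close to \<open>A\<close> in mean square, which turns
  \<open>\<Sum>n\<le>N. chi n * z^n\<close> into a bilinear sum; Cauchy-Schwarz then bounds it by geometric sums in
  \<open>z^(p - q)\<close> with \<open>p \<noteq> q\<close> in \<open>P\<close>, plus a diagonal that is negligible because \<open>A\<close> can be taken large. So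
  a large exponential sum forces \<open>norm (1 - z^Q) = O(1 / N)\<close>, with \<open>Q\<close> independent of \<open>chi\<close>.

  The kernel is a Fejer kernel dilated by the inverse of \<open>Q\<close> modulo \<open>M\<close>, whose Fourier coefficient at
  \<open>\<xi>\<close> is \<open>max 0 (1 - \<parallel>Q\<xi>\<parallel> / m)\<close>, where \<open>\<parallel>a\<parallel>\<close> is the distance from \<open>a\<close> to the multiples of \<open>M\<close>. It is
  close to \<open>1\<close> at every large coefficient of the truncated \<open>chi\<close>, so the uniform part has small Fourier
  coefficients and hence small \<open>U\<^sup>2\<close> norm. Only countably many \<open>\<theta>\<close> matter; along them \<open>Q\<close> grows by
  divisibility and \<open>m / Q\<close> increases, which makes the Fourier coefficients monotone.
\<close>

subsection \<open>The sum of the reciprocals of the primes\<close>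

lemma sum_inverse_squares_le: "(\<Sum>b\<in>{1..n}. 1 / (real b)\<^sup>2) \<le> 2"
proof -
  \<comment> \<open>The extra \<open>1 / real n\<close> is the slack that absorbs the next summand
    by telescoping.\<close>
  have "n \<ge> 1 \<Longrightarrow> (\<Sum>b\<in>{1..n}. 1 / (real b)\<^sup>2) \<le> 2 - 1 / real n"
  proof (induction n rule: nat_induct_at_least)
    case (Suc n)
    have "1 / (real (Suc n))\<^sup>2 \<le> 1 / (real n * real (Suc n))"
      using Suc.hyps by (intro divide_left_mono) (auto simp: power2_eq_square)
    also have "\<dots> = 1 / real n - 1 / real (Suc n)"
      using Suc.hyps by (simp add: field_simps)
    finally show ?case using Suc.IH by simp
  qed simp
  then show ?thesis by (cases "n = 0") (auto intro: order_trans)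
qed

lemma prod_prime_factors_squarefree:
  fixes n :: nat
  assumes "squarefree n"
  shows "\<Prod>(prime_factors n) = n"
proof -
  have "n \<noteq> 0" using assms by (metis not_squarefree_0)
  then have "(\<Prod>p\<in>prime_factors n. p ^ multiplicity p n) = n"
    by (simp add: prod_prime_factors)
  moreover have "p ^ multiplicity p n = p" if "p \<in> prime_factors n" for p
    using that assms \<open>n \<noteq> 0\<close> by (simp add: squarefree_factorial_semiring')
  ultimately show ?thesis by simp
qed

text \<open>Every \<open>k \<le> n\<close> is a squarefree number times a square, so the harmonic
  sum is dominated by the expanded product of \<open>1 + 1 / p\<close> over the primes
  \<open>p \<le> n\<close>, times a sum of inverse squares, which is at most \<open>2\<close>. Then
  \<open>1 + x \<le> exp x\<close> is applied to each factor.\<close>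

lemma harm_le_exp_sum_inverse_primes:
  "harm n \<le> 2 * exp (\<Sum>p | prime p \<and> p \<le> n. 1 / real p)"
proof -
  define P where "P = {p::nat. prime p \<and> p \<le> n}"
  have finP: "finite P" unfolding P_def by (rule finite_subset[of _ "{..n}"]) auto
  \<comment> \<open>The pair stores the primes of the squarefree part and the root of the square
    part. It determines \<open>k\<close>, and \<open>g\<close> recovers \<open>1 / k\<close> from
    it.\<close>
  define h where "h k = (prime_factors (squarefree_part k), square_part k)" for k :: nat
  define g where "g = (\<lambda>(S :: nat set, b). (\<Prod>p\<in>S. 1 / real p) * (1 / (real b)\<^sup>2))"
  have dec: "k = \<Prod>(fst (h k)) * (snd (h k))\<^sup>2" for k
    unfolding h_def by (simp add: prod_prime_factors_squarefree squarefree_decompose[symmetric])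
  have inj: "inj_on h {1..n}" by (rule inj_onI) (metis dec)
  have img: "h ` {1..n} \<subseteq> Pow P \<times> {1..n}"
  proof (rule image_subsetI)
    fix k assume "k \<in> {1..n}"
    then have k: "0 < k" "k \<le> n" by auto
    have d1: "squarefree_part k dvd k" and d2: "square_part k dvd k"
      by (metis dvd_triv_left squarefree_decompose)
        (metis dvd_trans dvd_power square_part_square_dvd pos2)
    have "square_part k \<in> {1..n}"
      using dvd_imp_le[OF d2] k by (simp add: Suc_le_eq neq0_conv[symmetric] del: neq0_conv)
    moreover have "p \<in> P" if "p \<in> prime_factors (squarefree_part k)" for p
    proof -
      have "prime p" "p dvd k" using that d1 by (auto dest: dvd_trans)
      then show ?thesis unfolding P_def using dvd_imp_le[of p k] k by simp
    qed
    ultimately show "h k \<in> Pow P \<times> {1..n}" unfolding h_def by blast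
  qed
  have "harm n = (\<Sum>k\<in>{1..n}. g (h k))"
  proof -
    have "inverse (real k) = g (h k)" for k
    proof -
      have "real k = (\<Prod>p\<in>fst (h k). real p) * (real (snd (h k)))\<^sup>2"
        by (subst dec[of k]) (simp del: of_nat_prod add: of_nat_prod[symmetric])
      then show ?thesis
        by (simp add: g_def case_prod_beta prod_dividef divide_simps)
    qed
    then show ?thesis by (simp add: harm_def)
  qed
  also have "\<dots> = (\<Sum>x\<in>h ` {1..n}. g x)" by (simp only: sum.reindex[OF inj] o_def)
  \<comment> \<open>Passing to all pairs adds only nonnegative terms and makes the sum
    factor.\<close>
  also have "\<dots> \<le> (\<Sum>x\<in>Pow P \<times> {1..n}. g x)"
    using img finP by (intro sum_mono2) (auto simp: g_def intro!: divide_nonneg_nonneg prod_nonneg)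
  also have "\<dots> = (\<Sum>S\<in>Pow P. \<Prod>p\<in>S. 1 / real p) * (\<Sum>b\<in>{1..n}. 1 / (real b)\<^sup>2)"
    unfolding g_def by (simp only: sum.cartesian_product[symmetric] sum_product)
  also have "(\<Sum>S\<in>Pow P. \<Prod>p\<in>S. 1 / real p) = (\<Prod>p\<in>P. 1 / real p + 1)"
    using prod_add[OF finP, of "\<lambda>p. 1 / real p" "\<lambda>_. 1"] by simp
  also have "(\<Prod>p\<in>P. 1 / real p + 1) * (\<Sum>b\<in>{1..n}. 1 / (real b)\<^sup>2) \<le> (\<Prod>p\<in>P. exp (1 / real p)) * 2"
    by (intro mult_mono prod_mono sum_inverse_squares_le conjI)
      (auto simp: add.commute[of _ 1] intro!: prod_nonneg sum_nonneg)
  also have "\<dots> = 2 * exp (\<Sum>p\<in>P. 1 / real p)" using finP by (simp add: exp_sum)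
  finally show ?thesis unfolding P_def .
qed

lemma sum_inverse_primes_unbounded:
  obtains P :: "nat set" where "finite P" "\<And>p. p \<in> P \<Longrightarrow> prime p" "B < (\<Sum>p\<in>P. 1 / real p)"
proof -
  obtain n where n: "2 * exp B < (harm n :: real)"
    using harm_at_top unfolding filterlim_at_top_dense by (metis eventually_sequentially le_refl)
  with harm_le_exp_sum_inverse_primes[of n]
  have "exp B < exp (\<Sum>p | prime p \<and> p \<le> n. 1 / real p)" by linarith
  then have "B < (\<Sum>p | prime p \<and> p \<le> n. 1 / real p)" by simp
  moreover have "finite {p. prime p \<and> p \<le> n}" by (rule finite_subset[of _ "{..n}"]) auto
  ultimately show ?thesis by (intro that[of "{p. prime p \<and> p \<le> n}"]) auto
qed

section \<open>Indicator sums and counting multiples\<close>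

lemma sum_of_bool_mult:
  fixes f :: "'i \<Rightarrow> 'a :: semiring_1"
  assumes "finite I"
  shows "(\<Sum>i\<in>I. of_bool (R i) * f i) = (\<Sum>i | i \<in> I \<and> R i. f i)"
  unfolding sum.inter_filter[OF assms] by (intro sum.cong) auto

lemma sum_sum_delta:
  fixes f :: "'i \<Rightarrow> 'a :: semiring_1"
  assumes "finite I"
  shows "(\<Sum>i\<in>I. \<Sum>j\<in>I. of_bool (i = j) * f i) = sum f I"
proof (intro sum.cong refl)
  fix i assume "i \<in> I"
  then have "{j. j \<in> I \<and> i = j} = {i}" by auto
  then show "(\<Sum>j\<in>I. of_bool (i = j) * f i) = f i"
    by (simp only: sum_of_bool_mult[OF assms]) simp
qed

lemma sum_of_bool_dvd:
  assumes "d > 0"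
  shows "(\<Sum>n\<in>{1..N}. of_bool (d dvd n)) = real (N div d)"
proof -
  have "{n\<in>{1..N}. d dvd n} = (\<lambda>m. d * m) ` {1..N div d}"
    using assms by (auto simp: less_eq_div_iff_mult_less_eq algebra_simps elim!: dvdE)
  moreover have "inj_on (\<lambda>m. d * m) {1..N div d}" using assms by (auto intro: inj_onI)
  ultimately have "card {n\<in>{1..N}. d dvd n} = N div d" by (simp add: card_image)
  then show ?thesis by (simp add: of_bool_def sum.If_cases Int_def)
qed

subsection \<open>Exponential sums of multiplicative functions\<close>

text \<open>A variance computation. The first moment is at least \<open>N * A - card P\<close>,
  since each floor loses less than \<open>1\<close>; the second is at most
  \<open>N * A\<^sup>2 + N * A\<close>, the last term coming from the diagonal. On expanding the
  square the terms \<open>N * A\<^sup>2\<close> cancel.\<close>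

lemma turan_kubilius:
  fixes P :: "nat set" and N :: nat
  defines "A \<equiv> (\<Sum>p\<in>P. 1 / real p)"
  assumes "finite P" and prime: "\<And>p. p \<in> P \<Longrightarrow> prime p"
  shows "(\<Sum>n\<in>{1..N}. ((\<Sum>p\<in>P. of_bool (p dvd n)) - A)\<^sup>2) \<le> real N * A + 2 * A * real (card P)"
proof -
  define w where "w n = (\<Sum>p\<in>P. of_bool (p dvd n) :: real)" for n
  have A0: "A \<ge> 0" unfolding A_def by (intro sum_nonneg) auto
  have pos: "p > 0" if "p \<in> P" for p using prime[OF that] by (simp add: prime_gt_0_nat)
  have lower: "real N * A - card P \<le> (\<Sum>n\<in>{1..N}. w n)"
  proof -
    have "real N * A - card P = (\<Sum>p\<in>P. real N / real p - 1)"
      by (simp add: A_def sum_distrib_left sum_subtractf)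
    also have "\<dots> \<le> (\<Sum>p\<in>P. real (N div p))"
    proof (rule sum_mono)
      fix p
      show "real N / real p - 1 \<le> real (N div p)"
        using floor_correct[of "real N / real p"] by (simp add: floor_divide_of_nat_eq)
    qed
    also have "\<dots> = (\<Sum>p\<in>P. \<Sum>n\<in>{1..N}. of_bool (p dvd n))"
      by (intro sum.cong refl sum_of_bool_dvd[symmetric] pos)
    also have "\<dots> = (\<Sum>n\<in>{1..N}. w n)" unfolding w_def by (rule sum.swap)
    finally show ?thesis .
  qed
  have upper: "(\<Sum>n\<in>{1..N}. (w n)\<^sup>2) \<le> real N * A\<^sup>2 + real N * A"
  proof -
    \<comment> \<open>Both \<open>p\<close> and \<open>q\<close> divide \<open>n\<close> exactly
      when their \<open>lcm\<close> does, so the second moment counts multiples.\<close>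
    have "(\<Sum>n\<in>{1..N}. (w n)\<^sup>2) = (\<Sum>n\<in>{1..N}. \<Sum>p\<in>P. \<Sum>q\<in>P. of_bool (lcm p q dvd n))"
      unfolding w_def power2_eq_square
      by (simp only: sum_product of_bool_conj[symmetric] lcm_least_iff)
    also have "\<dots> = (\<Sum>p\<in>P. \<Sum>n\<in>{1..N}. \<Sum>q\<in>P. of_bool (lcm p q dvd n))" by (rule sum.swap)
    also have "\<dots> = (\<Sum>p\<in>P. \<Sum>q\<in>P. \<Sum>n\<in>{1..N}. of_bool (lcm p q dvd n))"
      by (intro sum.cong refl sum.swap)
    also have "\<dots> = (\<Sum>p\<in>P. \<Sum>q\<in>P. real (N div lcm p q))"
      using pos by (intro sum.cong refl sum_of_bool_dvd) (auto intro: lcm_pos_nat)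
    also have "\<dots> \<le> (\<Sum>p\<in>P. \<Sum>q\<in>P. real N * (1 / real p * (1 / real q)) + of_bool (p = q) * (real N * (1 / real p)))"
    proof (intro sum_mono)
      fix p q assume pq: "p \<in> P" "q \<in> P"
      show "real (N div lcm p q) \<le> real N * (1 / real p * (1 / real q)) + of_bool (p = q) * (real N * (1 / real p))"
      proof (cases "p = q")
        case True
        then show ?thesis using of_nat_div_le_of_nat[of N p, where 'a = real] by (simp add: add_increasing)
      next
        case False
        then have "lcm p q = p * q"
          using pq prime by (simp add: lcm_coprime primes_coprime)
        then show ?thesis using False of_nat_div_le_of_nat[of N "p * q", where 'a = real] by simp
      qed
    qed
    also have "\<dots> = real N * A\<^sup>2 + real N * A"
    proof -
      have "A\<^sup>2 = (\<Sum>p\<in>P. \<Sum>q\<in>P. 1 / real p * (1 / real q))"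
        by (simp only: A_def power2_eq_square sum_product)
      then show ?thesis
        unfolding sum.distrib sum_sum_delta[OF \<open>finite P\<close>] by (simp only: A_def sum_distrib_left)
    qed
    finally show ?thesis .
  qed
  have "(\<Sum>n\<in>{1..N}. (w n - A)\<^sup>2) = (\<Sum>n\<in>{1..N}. (w n)\<^sup>2) - 2 * A * (\<Sum>n\<in>{1..N}. w n) + real N * A\<^sup>2"
    by (simp add: power2_diff sum.distrib sum_subtractf sum_distrib_left algebra_simps)
  also have "\<dots> \<le> real N * A\<^sup>2 + real N * A - 2 * A * (real N * A - card P) + real N * A\<^sup>2"
    using upper mult_left_mono[OF lower, of "2 * A"] A0 by simp
  also have "\<dots> = real N * A + 2 * A * card P" by (simp add: algebra_simps power2_eq_square)
  finally show ?thesis unfolding w_def .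
qed

lemma norm_sum_squared_le:
  fixes f :: "'i \<Rightarrow> 'a :: real_normed_vector"
  shows "(norm (\<Sum>i\<in>I. f i))\<^sup>2 \<le> real (card I) * (\<Sum>i\<in>I. (norm (f i))\<^sup>2)"
proof -
  have "(norm (\<Sum>i\<in>I. f i))\<^sup>2 \<le> (\<Sum>i\<in>I. norm (f i))\<^sup>2" by (intro power_mono norm_sum) simp
  also have "\<dots> \<le> real (card I) * (\<Sum>i\<in>I. (norm (f i))\<^sup>2)"
    using sum_squared_le_sum_of_squares[of "\<lambda>i. norm (f i)" I] by (cases "finite I") (auto simp: mult.commute)
  finally show ?thesis .
qed

text \<open>The product form remains meaningful at \<open>z = 1\<close>, where the closed formula
  would divide by zero.\<close>

lemma norm_geometric_sum_le:
  fixes z :: complex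
  assumes "norm z = 1"
  shows "norm (1 - z) * norm (\<Sum>m\<in>{1..M}. z ^ m) \<le> 2"
proof -
  have "(1 - z) * (\<Sum>m\<in>{1..M}. z ^ m) = z - z ^ Suc M"
  proof (induction M)
    case (Suc M)
    have "(1 - z) * (\<Sum>m\<in>{1..Suc M}. z ^ m) = (1 - z) * (\<Sum>m\<in>{1..M}. z ^ m) + (1 - z) * z ^ Suc M"
      by (simp add: distrib_left)
    then show ?case by (simp only: Suc.IH) (simp add: algebra_simps)
  qed simp
  then have "norm (1 - z) * norm (\<Sum>m\<in>{1..M}. z ^ m) = norm (z - z ^ Suc M)"
    by (metis norm_mult)
  also have "\<dots> \<le> 2" using norm_triangle_ineq4[of z "z ^ Suc M"] assms by (simp add: norm_mult norm_power)
  finally show ?thesis .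
qed

text \<open>Expanding the square leaves a geometric sum for each pair \<open>p\<close>,
  \<open>q\<close>. The diagonal contributes at most \<open>N / p\<close> each, in total
  \<open>N * A\<close>; the at most \<open>(card P)\<^sup>2\<close> other pairs contribute at most
  \<open>A * N\<close> together by \<open>gp\<close>. The values of \<open>chi\<close> enter only
  through their modulus.\<close>

lemma katai_second_moment:
  fixes z :: complex and N :: nat and P :: "nat set"
  defines "A \<equiv> (\<Sum>p\<in>P. 1 / real p)"
  assumes chi: "chi \<in> unimodular_cmult" and z: "norm z = 1"
    and "finite P" and prime: "\<And>p. p \<in> P \<Longrightarrow> prime p"
    and gp: "\<And>p q M. p \<in> P \<Longrightarrow> q \<in> P \<Longrightarrow> p \<noteq> q \<Longrightarrow> M \<le> N \<Longrightarrow>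
        norm (\<Sum>m\<in>{1..M}. (z ^ p * cnj (z ^ q)) ^ m) * (real (card P))\<^sup>2 \<le> A * N"
  shows "(\<Sum>m\<in>{1..N}. (norm (\<Sum>p\<in>P. of_bool (p * m \<le> N) * (chi p * z ^ (p * m))))\<^sup>2) \<le> 2 * A * real N"
proof -
  have A0: "A \<ge> 0" unfolding A_def by (intro sum_nonneg) auto
  have pos: "p > 0" if "p \<in> P" for p using prime[OF that] by (simp add: prime_gt_0_nat)
  define g where "g m = (\<Sum>p\<in>P. of_bool (p * m \<le> N) * (chi p * z ^ (p * m)))" for m
  define G where "G p q = (\<Sum>m\<in>{1..min (N div p) (N div q)}. (z ^ p * cnj (z ^ q)) ^ m)" for p q
  have norm_chi: "norm (chi p) = 1" if "p \<in> P" for p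
    using chi pos[OF that] by (simp add: unimodular_cmult_def)
  have "complex_of_real (\<Sum>m\<in>{1..N}. (norm (g m))\<^sup>2) = (\<Sum>m\<in>{1..N}. g m * cnj (g m))"
    by (simp only: of_real_sum complex_norm_square)
  also have "\<dots> = (\<Sum>m\<in>{1..N}. \<Sum>p\<in>P. \<Sum>q\<in>P. chi p * cnj (chi q) *
      (of_bool (p * m \<le> N \<and> q * m \<le> N) * (z ^ p * cnj (z ^ q)) ^ m))"
    unfolding g_def cnj_sum sum_product
    by (intro sum.cong refl) (auto simp: power_mult power_mult_distrib)
  also have "\<dots> = (\<Sum>p\<in>P. \<Sum>q\<in>P. \<Sum>m\<in>{1..N}. chi p * cnj (chi q) *
      (of_bool (p * m \<le> N \<and> q * m \<le> N) * (z ^ p * cnj (z ^ q)) ^ m))"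
    by (subst sum.swap) (intro sum.cong refl sum.swap)
  also have "\<dots> = (\<Sum>p\<in>P. \<Sum>q\<in>P. chi p * cnj (chi q) * G p q)"
  proof (intro sum.cong refl)
    fix p q assume pq: "p \<in> P" "q \<in> P"
    \<comment> \<open>The two cutoffs merge into one initial segment, which makes the inner sum
      geometric.\<close>
    have eq: "{m\<in>{1..N}. p * m \<le> N \<and> q * m \<le> N} = {1..min (N div p) (N div q)}"
    proof -
      have "(p * m \<le> N \<and> q * m \<le> N) = (m \<le> min (N div p) (N div q))" for m
        using pos pq by (simp add: less_eq_div_iff_mult_less_eq mult.commute)
      moreover have "min (N div p) (N div q) \<le> N" by (simp add: min.coboundedI1)
      ultimately have "m \<in> {m\<in>{1..N}. p * m \<le> N \<and> q * m \<le> N} \<longleftrightarrow> m \<in> {1..min (N div p) (N div q)}" for m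
        by (metis (no_types, lifting) atLeastAtMost_iff mem_Collect_eq order_trans)
      then show ?thesis by blast
    qed
    show "(\<Sum>m\<in>{1..N}. chi p * cnj (chi q) *
        (of_bool (p * m \<le> N \<and> q * m \<le> N) * (z ^ p * cnj (z ^ q)) ^ m)) = chi p * cnj (chi q) * G p q"
      unfolding G_def eq[symmetric] sum_distrib_left[symmetric]
      by (subst sum_of_bool_mult) auto
  qed
  finally have eq: "complex_of_real (\<Sum>m\<in>{1..N}. (norm (g m))\<^sup>2) = (\<Sum>p\<in>P. \<Sum>q\<in>P. chi p * cnj (chi q) * G p q)" .
  have "(\<Sum>m\<in>{1..N}. (norm (g m))\<^sup>2) = norm (complex_of_real (\<Sum>m\<in>{1..N}. (norm (g m))\<^sup>2))"
    by (simp only: norm_of_real abs_of_nonneg[OF sum_nonneg] zero_le_power2)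
  also have "\<dots> \<le> (\<Sum>p\<in>P. norm (\<Sum>q\<in>P. chi p * cnj (chi q) * G p q))"
    unfolding eq by (rule norm_sum)
  also have "\<dots> \<le> (\<Sum>p\<in>P. \<Sum>q\<in>P. norm (chi p * cnj (chi q) * G p q))"
    by (intro sum_mono norm_sum)
  also have "\<dots> \<le> (\<Sum>p\<in>P. \<Sum>q\<in>P. of_bool (p = q) * (real N * (1 / real p)) + A * N / (real (card P))\<^sup>2)"
  proof (intro sum_mono)
    fix p q assume pq: "p \<in> P" "q \<in> P"
    then have card: "card P > 0" using \<open>finite P\<close> by (auto simp: card_gt_0_iff)
    show "norm (chi p * cnj (chi q) * G p q) \<le> of_bool (p = q) * (real N * (1 / real p)) + A * N / (real (card P))\<^sup>2"
    proof (cases "p = q")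
      case True
      have "norm (G p q) \<le> (\<Sum>m\<in>{1..N div p}. norm ((z ^ p * cnj (z ^ q)) ^ m))"
        unfolding G_def True by (rule order_trans[OF norm_sum]) simp
      also have "\<dots> \<le> real N / real p"
        using z of_nat_div_le_of_nat[of N p, where 'a = real] by (simp add: norm_mult norm_power)
      finally show ?thesis using pq norm_chi A0 True by (simp add: norm_mult add_increasing2)
    next
      case False
      have "min (N div p) (N div q) \<le> N" by (simp add: min.coboundedI1)
      from gp[OF pq False this] show ?thesis
        using pq norm_chi card False by (simp add: norm_mult G_def field_simps)
    qed
  qed
  also have "\<dots> = real N * A + real (card P) * (real (card P) * (A * N / (real (card P))\<^sup>2))"
    unfolding sum.distrib sum_sum_delta[OF \<open>finite P\<close>] by (simp add: A_def sum_distrib_left)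
  also have "\<dots> \<le> 2 * A * real N" using A0 by (cases "card P = 0") (auto simp: power2_eq_square)
  finally show ?thesis unfolding g_def .
qed

text \<open>Weighting each term by its number \<open>w n\<close> of prime divisors in
  \<open>P\<close> gives \<open>T\<close>. Turan-Kubilius shows that \<open>T\<close> is within
  \<open>sqrt (2 * A) * N\<close> of \<open>A\<close> times the sum; Cauchy-Schwarz and the second
  moment bound \<open>T\<close> by the same quantity.\<close>

lemma katai_inequality:
  fixes z :: complex and N :: nat and P :: "nat set"
  defines "A \<equiv> (\<Sum>p\<in>P. 1 / real p)"
  assumes chi: "chi \<in> unimodular_cmult" and z: "norm z = 1"
    and "finite P" and prime: "\<And>p. p \<in> P \<Longrightarrow> prime p" and N: "2 * card P \<le> N"
    and gp: "\<And>p q M. p \<in> P \<Longrightarrow> q \<in> P \<Longrightarrow> p \<noteq> q \<Longrightarrow> M \<le> N \<Longrightarrow>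
        norm (\<Sum>m\<in>{1..M}. (z ^ p * cnj (z ^ q)) ^ m) * (real (card P))\<^sup>2 \<le> A * N"
  shows "A * norm (\<Sum>n\<in>{1..N}. chi n * z ^ n) \<le> 2 * sqrt (2 * A) * N"
proof -
  have A0: "A \<ge> 0" unfolding A_def by (intro sum_nonneg) auto
  have pos: "p > 0" if "p \<in> P" for p using prime[OF that] by (simp add: prime_gt_0_nat)
  have norm_chi: "norm (chi n) = 1" if "n > 0" for n
    using chi that by (simp add: unimodular_cmult_def)
  define f where "f n = chi n * z ^ n" for n
  define w where "w n = (\<Sum>p\<in>P. of_bool (p dvd n) :: real)" for n
  define g where "g m = (\<Sum>p\<in>P. of_bool (p * m \<le> N) * (chi p * z ^ (p * m)))" for m
  define T where "T = (\<Sum>n\<in>{1..N}. f n * of_real (w n))"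
  have norm_f: "norm (f n) = 1" if "n > 0" for n
    using that by (simp add: f_def norm_mult norm_power z norm_chi)
  have "T = (\<Sum>n\<in>{1..N}. \<Sum>p\<in>P. of_bool (p dvd n) * f n)"
    unfolding T_def w_def of_real_sum sum_distrib_left by (intro sum.cong refl) (simp add: of_bool_def)
  also have "\<dots> = (\<Sum>p\<in>P. \<Sum>n\<in>{1..N}. of_bool (p dvd n) * f n)" by (rule sum.swap)
  \<comment> \<open>Substitute \<open>n = p * m\<close>. The indicator keeps the range of
    \<open>m\<close> independent of \<open>p\<close>, so that the sums can be interchanged.\<close>
  also have "\<dots> = (\<Sum>p\<in>P. \<Sum>m\<in>{1..N}. of_bool (p * m \<le> N) * f (p * m))"
  proof (rule sum.cong[OF refl])
    fix p assume "p \<in> P"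
    note p = pos[OF this]
    have "(\<Sum>n\<in>{1..N}. of_bool (p dvd n) * f n) = (\<Sum>n\<in>{n\<in>{1..N}. p dvd n}. f n)"
      by (simp only: sum_of_bool_mult finite_atLeastAtMost)
    also have "{n\<in>{1..N}. p dvd n} = (\<lambda>m. p * m) ` {m\<in>{1..N}. p * m \<le> N}"
    proof (intro equalityI subsetI)
      fix n assume "n \<in> {n\<in>{1..N}. p dvd n}"
      then obtain m where m: "n = p * m" "1 \<le> p * m" "p * m \<le> N" by (auto elim!: dvdE)
      then have "m \<ge> 1" by (cases m) auto
      moreover have "m \<le> N" using m(3) mult_le_mono1[of 1 p m] p by linarith
      ultimately show "n \<in> (\<lambda>m. p * m) ` {m\<in>{1..N}. p * m \<le> N}" using m by auto
    next
      fix n assume "n \<in> (\<lambda>m. p * m) ` {m\<in>{1..N}. p * m \<le> N}"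
      then show "n \<in> {n\<in>{1..N}. p dvd n}" using p by (auto simp: Suc_le_eq)
    qed
    also have "sum f \<dots> = (\<Sum>m\<in>{m\<in>{1..N}. p * m \<le> N}. f (p * m))"
      using p by (subst sum.reindex) (auto intro: inj_onI)
    also have "\<dots> = (\<Sum>m\<in>{1..N}. of_bool (p * m \<le> N) * f (p * m))"
      by (simp only: sum_of_bool_mult finite_atLeastAtMost)
    finally show "(\<Sum>n\<in>{1..N}. of_bool (p dvd n) * f n) = (\<Sum>m\<in>{1..N}. of_bool (p * m \<le> N) * f (p * m))" .
  qed
  also have "\<dots> = (\<Sum>m\<in>{1..N}. \<Sum>p\<in>P. of_bool (p * m \<le> N) * f (p * m))" by (rule sum.swap)
  also have "\<dots> = (\<Sum>m\<in>{1..N}. chi m * g m)"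
    unfolding g_def sum_distrib_left
  proof (intro sum.cong refl)
    fix m p assume "m \<in> {1..N}" "p \<in> P"
    \<comment> \<open>Complete multiplicativity covers also the \<open>m\<close> divisible by
      \<open>p\<close>.\<close>
    then have "chi (p * m) = chi p * chi m" using chi pos[of p] by (simp add: unimodular_cmult_def Suc_le_eq)
    then show "of_bool (p * m \<le> N) * f (p * m) = chi m * (of_bool (p * m \<le> N) * (chi p * z ^ (p * m)))"
      by (simp add: f_def)
  qed
  finally have T: "T = (\<Sum>m\<in>{1..N}. chi m * g m)" .
  have sq: "real N * (2 * A * real N) = (sqrt (2 * A) * N)\<^sup>2"
    using A0 by (simp only: power_mult_distrib real_sqrt_pow2) (simp add: power2_eq_square)
  have "(norm T)\<^sup>2 \<le> real N * (\<Sum>m\<in>{1..N}. (norm (chi m * g m))\<^sup>2)"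
    unfolding T using norm_sum_squared_le[of "\<lambda>m. chi m * g m" "{1..N}"] by simp
  also have "(\<Sum>m\<in>{1..N}. (norm (chi m * g m))\<^sup>2) = (\<Sum>m\<in>{1..N}. (norm (g m))\<^sup>2)"
    by (intro sum.cong refl) (simp add: norm_mult norm_chi)
  also have "real N * \<dots> \<le> real N * (2 * A * real N)"
    unfolding g_def A_def using katai_second_moment[OF chi z \<open>finite P\<close> prime gp[unfolded A_def]]
    by (intro mult_left_mono) simp_all
  also note sq
  finally have 1: "norm T \<le> sqrt (2 * A) * N" by (rule power2_le_imp_le) (use A0 in simp)
  have "A * (\<Sum>n\<in>{1..N}. f n) - T = (\<Sum>n\<in>{1..N}. f n * of_real (A - w n))"
    unfolding T_def sum_distrib_left sum_subtractf[symmetric]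
    by (intro sum.cong refl) (simp only: of_real_diff right_diff_distrib mult.commute)
  then have "(norm (A * (\<Sum>n\<in>{1..N}. f n) - T))\<^sup>2 \<le> real N * (\<Sum>n\<in>{1..N}. (norm (f n * of_real (A - w n)))\<^sup>2)"
    using norm_sum_squared_le[of "\<lambda>n. f n * of_real (A - w n)" "{1..N}"] by simp
  also have "(\<Sum>n\<in>{1..N}. (norm (f n * of_real (A - w n)))\<^sup>2) = (\<Sum>n\<in>{1..N}. (w n - A)\<^sup>2)"
    by (intro sum.cong refl) (simp add: norm_mult norm_f power2_commute del: of_real_diff)
  also have "\<dots> \<le> real N * A + 2 * A * real (card P)"
    unfolding w_def A_def using turan_kubilius[OF \<open>finite P\<close> prime] by simp
  \<comment> \<open>The assumption \<open>2 * card P \<le> N\<close> absorbs the floor error of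
    Turan-Kubilius.\<close>
  also have "\<dots> \<le> 2 * A * N" using N mult_left_mono[of "real (2 * card P)" "real N" A] A0 by simp
  also note sq
  finally have 2: "norm (A * (\<Sum>n\<in>{1..N}. f n) - T) \<le> sqrt (2 * A) * N"
    by (rule power2_le_imp_le[OF _ mult_nonneg_nonneg]) (use A0 in \<open>simp_all add: mult_left_mono\<close>)
  have "A * norm (\<Sum>n\<in>{1..N}. f n) = norm (A * (\<Sum>n\<in>{1..N}. f n))" using A0 by (simp add: norm_mult)
  also have "\<dots> \<le> 2 * sqrt (2 * A) * N" using norm_triangle_sub[of "A * (\<Sum>n\<in>{1..N}. f n)" T] 1 2 by simp
  finally show ?thesis unfolding f_def .
qed

text \<open>Katai's inequality is used in contrapositive form: a large sum makes \<open>gp\<close>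
  fail for some pair, so some geometric sum in \<open>z ^ p * cnj (z ^ q)\<close> is of order
  \<open>N\<close>, and its ratio must lie within \<open>O(1 / N)\<close> of
  \<open>1\<close>.\<close>

lemma large_exponential_sum:
  fixes \<epsilon> :: real
  assumes "\<epsilon> > 0"
  obtains Q :: nat and C :: real and N0 :: nat where "Q > 0"
    "\<And>N chi z. N \<ge> N0 \<Longrightarrow> chi \<in> unimodular_cmult \<Longrightarrow> norm z = 1 \<Longrightarrow>
       \<epsilon> * N \<le> norm (\<Sum>n\<in>{1..N}. chi n * z ^ n) \<Longrightarrow> norm (1 - z ^ Q) * N \<le> C"
proof -
  \<comment> \<open>The conclusion of Katai's inequality would give
    \<open>A * \<epsilon> \<le> 2 * sqrt (2 * A)\<close>, that is
    \<open>A * \<epsilon>\<^sup>2 \<le> 8\<close>; the threshold excludes this.\<close>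
  obtain P :: "nat set" where P: "finite P" "\<And>p. p \<in> P \<Longrightarrow> prime p"
    and large: "8 / \<epsilon>\<^sup>2 < (\<Sum>p\<in>P. 1 / real p)"
    using sum_inverse_primes_unbounded by blast
  define A where "A = (\<Sum>p\<in>P. 1 / real p)"
  have "8 / \<epsilon>\<^sup>2 > 0" using assms by simp
  then have A0: "A > 0" using large unfolding A_def by linarith
  \<comment> \<open>The failing pair depends on \<open>chi\<close>, \<open>z\<close> and
    \<open>N\<close>, but this factorial is divisible by every difference of two distinct elements
    of \<open>P\<close>.\<close>
  define Q where "Q = (fact (\<Sum>P) :: nat)"
  \<comment> \<open>The bracket bounds \<open>norm (1 - u) * N\<close>; the factor \<open>Q\<close>
    pays for passing from \<open>z ^ d\<close> to \<open>z ^ Q\<close>.\<close>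
  define C where "C = Q * (2 * (real (card P))\<^sup>2 / A)"
  have main: "norm (1 - z ^ Q) * N \<le> C"
    if N: "N \<ge> Suc (2 * card P)" and chi: "chi \<in> unimodular_cmult" and z: "norm z = 1"
      and big: "\<epsilon> * N \<le> norm (\<Sum>n\<in>{1..N}. chi n * z ^ n)" for N chi z
  proof -
    have "\<not> A * norm (\<Sum>n\<in>{1..N}. chi n * z ^ n) \<le> 2 * sqrt (2 * A) * N"
    proof
      assume "A * norm (\<Sum>n\<in>{1..N}. chi n * z ^ n) \<le> 2 * sqrt (2 * A) * N"
      then have "A * (\<epsilon> * N) \<le> 2 * sqrt (2 * A) * N"
        using mult_left_mono[OF big, of A] A0 by linarith
      then have "A * \<epsilon> \<le> 2 * sqrt (2 * A)" using N by (simp flip: mult.assoc)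
      then have "(A * \<epsilon>)\<^sup>2 \<le> (2 * sqrt (2 * A))\<^sup>2" using A0 assms by (intro power_mono) auto
      also have "(2 * sqrt (2 * A))\<^sup>2 = A * 8"
        unfolding power_mult_distrib by (subst real_sqrt_pow2) (use A0 in simp_all)
      also have "(A * \<epsilon>)\<^sup>2 = A * (A * \<epsilon>\<^sup>2)" by (simp add: power2_eq_square)
      finally have "A * \<epsilon>\<^sup>2 \<le> 8" using A0 by simp
      then show False using large assms by (simp add: A_def[symmetric] field_simps)
    qed
    then obtain p q M where pq: "p \<in> P" "q \<in> P" "p \<noteq> q" and "M \<le> N"
      and G: "A * N < norm (\<Sum>m\<in>{1..M}. (z ^ p * cnj (z ^ q)) ^ m) * (real (card P))\<^sup>2"
      using katai_inequality[OF chi z P, of N] N unfolding A_def by (metis Suc_leD not_le)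
    define u where "u = z ^ p * cnj (z ^ q)"
    have "norm (1 - u) * (A * N) \<le> norm (1 - u) * (norm (\<Sum>m\<in>{1..M}. u ^ m) * (real (card P))\<^sup>2)"
      using G unfolding u_def by (intro mult_left_mono) auto
    also have "\<dots> \<le> 2 * (real (card P))\<^sup>2"
      using norm_geometric_sum_le[of u M] z
      by (simp add: u_def norm_mult norm_power mult_right_mono flip: mult.assoc)
    finally have small: "norm (1 - u) * N \<le> 2 * (real (card P))\<^sup>2 / A" using A0 by (simp add: field_simps)
    \<comment> \<open>The case split gives the absolute difference despite truncated subtraction.
      Since \<open>z\<close> has modulus \<open>1\<close>, \<open>u\<close> is \<open>z ^ d\<close>
      or its conjugate.\<close>
    define d where "d = (if p > q then p - q else q - p)"
    have d_eq: "norm (1 - z ^ d) = norm (1 - u)"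
    proof -
      have u: "u * z ^ q = z ^ p"
        using z by (simp add: u_def complex_norm_square[symmetric] norm_power mult.assoc mult.commute[of "cnj _"] flip: complex_cnj_power)
      have "norm (1 - u) = norm ((1 - u) * z ^ q)" using z by (simp add: norm_mult norm_power)
      also have "\<dots> = norm (z ^ q - z ^ p)" by (simp add: algebra_simps u)
      also have "\<dots> = norm ((1 - z ^ d) * z ^ min p q)"
        by (auto simp: d_def algebra_simps power_add[symmetric] norm_minus_commute)
      finally show ?thesis using z by (simp add: norm_mult norm_power)
    qed
    have "d dvd Q"
    proof -
      have "p \<le> \<Sum>P" "q \<le> \<Sum>P" using P pq by (auto intro: member_le_sum)
      then show ?thesis unfolding Q_def using pq by (intro dvd_fact) (auto simp: d_def)
    qed
    then obtain t where t: "Q = d * t" by (elim dvdE)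
    then have "Q > 0 \<Longrightarrow> t \<le> Q" by (cases d) auto
    then have tQ: "t \<le> Q" by (simp add: Q_def)
    have "norm (1 - z ^ Q) \<le> t * norm (1 - z ^ d)"
      using norm_power_diff[of 1 "z ^ d" t] z by (simp add: t power_mult norm_power)
    also have "\<dots> \<le> Q * norm (1 - z ^ d)" using tQ by (intro mult_right_mono) auto
    finally have "norm (1 - z ^ Q) * N \<le> Q * (norm (1 - u) * N)"
      unfolding d_eq by (simp add: mult_right_mono flip: mult.assoc)
    also have "\<dots> \<le> C" unfolding C_def using small by (intro mult_left_mono) auto
    finally show ?thesis .
  qed
  show ?thesis by (rule that[of Q, OF _ main]) (auto simp: Q_def)
qed

subsection \<open>Fourier analysis modulo M\<close>

text \<open>The integer argument allows congruences modulo \<open>M\<close> to be applied directly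
  to the character.\<close>

definition e_mod :: "nat \<Rightarrow> int \<Rightarrow> complex" where
  "e_mod M j = e_char (of_int j / of_nat M)"

lemma e_mod_eq_exp: "e_mod M j = exp (\<i> * of_real (2 * pi * of_int j / of_nat M))"
  by (simp add: e_mod_def e_char_def mult_ac)

lemma e_mod_0 [simp]: "e_mod M 0 = 1"
  by (simp add: e_mod_eq_exp)

lemma norm_e_mod [simp]: "norm (e_mod M j) = 1"
  unfolding e_mod_eq_exp by (rule norm_exp_i_times)

lemma e_mod_add: "e_mod M (i + j) = e_mod M i * e_mod M j"
  by (simp add: e_mod_eq_exp exp_add[symmetric] add_divide_distrib algebra_simps)

lemma e_mod_diff: "e_mod M (i - j) = e_mod M i * e_mod M (- j)"
  using e_mod_add[of M i "- j"] by simp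

lemma cnj_e_mod [simp]: "cnj (e_mod M j) = e_mod M (- j)"
  by (simp add: e_mod_eq_exp exp_cnj)

lemma e_mod_power: "e_mod M j ^ n = e_mod M (int n * j)"
  by (induction n) (simp_all add: distrib_right e_mod_add)

lemma norm_e_mod_diff_1: "norm (e_mod M j - 1) = 2 * \<bar>sin (pi * of_int j / of_nat M)\<bar>"
  unfolding e_mod_eq_exp dist_exp_i_1 by simp

lemma e_mod_eq_1_iff:
  assumes "M > 0"
  shows "e_mod M j = 1 \<longleftrightarrow> int M dvd j"
proof -
  have "2 * pi * of_int j / real M = of_int (2 * n) * pi \<longleftrightarrow> of_int j / real M = of_int n" for n
    using assms by (simp add: field_simps)
  then have "e_mod M j = 1 \<longleftrightarrow> (\<exists>n. of_int j / real M = of_int n)"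
    unfolding e_mod_eq_exp exp_eq_1 by simp
  also have "\<dots> \<longleftrightarrow> (\<exists>n. real_of_int j = of_int (int M * n))"
    using assms by (simp add: field_simps)
  also have "\<dots> \<longleftrightarrow> int M dvd j" unfolding of_int_eq_iff dvd_def ..
  finally show ?thesis .
qed

lemma e_mod_cong:
  assumes "M > 0" "int M dvd i - j"
  shows "e_mod M i = e_mod M j"
  using e_mod_add[of M "i - j" j] assms e_mod_eq_1_iff[of M "i - j"] by simp

lemma norm_e_mod_diff_1_le: "norm (e_mod M j - 1) \<le> 2 * pi * \<bar>of_int j\<bar> / of_nat M"
proof -
  have "\<bar>sin (pi * of_int j / of_nat M)\<bar> \<le> \<bar>pi * of_int j / of_nat M\<bar>" by (rule abs_sin_x_le_abs_x)
  then show ?thesis unfolding norm_e_mod_diff_1 by (simp add: abs_mult)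
qed

text \<open>Since \<open>pi / 2 < 1.6\<close>, \<open>x\<^sup>2 \<le> 3\<close> here, so the cubic
  Taylor error \<open>\<bar>x\<bar> ^ 3 / 6\<close> is at most half of
  \<open>\<bar>x\<bar>\<close>.\<close>

lemma half_abs_le_abs_sin:
  fixes x :: real
  assumes "\<bar>x\<bar> \<le> pi / 2"
  shows "\<bar>x\<bar> / 2 \<le> \<bar>sin x\<bar>"
proof -
  have "x\<^sup>2 \<le> 3"
  proof -
    have "x\<^sup>2 \<le> 1.6\<^sup>2" using assms pi_approx by (intro abs_le_square_iff[THEN iffD1]) auto
    then show ?thesis by (simp add: power2_eq_square)
  qed
  then have "\<bar>x\<bar> ^ 3 \<le> 3 * \<bar>x\<bar>"
    using mult_right_mono[of "x\<^sup>2" 3 "\<bar>x\<bar>"] by (simp add: power2_eq_square power3_eq_cube abs_mult[symmetric] flip: power2_abs)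
  moreover have "\<bar>sin x - x\<bar> \<le> \<bar>x\<bar> ^ 3 / 6"
    using Maclaurin_sin_bound[of x 3] by (simp add: sin_coeff_def numeral_eq_Suc)
  ultimately show ?thesis by linarith
qed

text \<open>Converse to the preceding chord bound, up to a constant: a phase near \<open>1\<close>
  has a small least residue. The restriction on \<open>j\<close> keeps the angle in the range of the
  sine bound.\<close>

lemma norm_e_mod_diff_1_ge:
  assumes "2 * \<bar>j\<bar> \<le> int M"
  shows "\<bar>of_int j\<bar> \<le> of_nat M * norm (e_mod M j - 1)"
proof (cases "M = 0")
  case False
  define x where "x = pi * of_int j / of_nat M"
  have "2 * \<bar>real_of_int j\<bar> \<le> real M" using assms by linarith
  then have "\<bar>x\<bar> \<le> pi / 2" using False by (simp add: x_def abs_mult field_simps)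
  then have "\<bar>x\<bar> \<le> norm (e_mod M j - 1)"
    using half_abs_le_abs_sin[of x] by (simp add: norm_e_mod_diff_1 x_def)
  moreover have "\<bar>real_of_int j\<bar> \<le> pi * \<bar>real_of_int j\<bar>" using pi_gt3 by (simp add: mult_le_cancel_right1)
  ultimately show ?thesis using False by (simp add: x_def abs_mult field_simps)
qed (use assms in auto)

lemma sum_e_mod:
  assumes "M > 0"
  shows "(\<Sum>n\<in>{1..int M}. e_mod M (n * j)) = of_nat M * of_bool (int M dvd j)"
proof (cases "int M dvd j")
  case True
  then have "e_mod M (n * j) = 1" for n using assms by (simp add: e_mod_eq_1_iff)
  then show ?thesis using True by simp
next
  case False
  define S where "S = (\<Sum>n\<in>{1..int M}. e_mod M (n * j))"
  \<comment> \<open>Shifting the index multiplies \<open>S\<close> by \<open>e_mod M j\<close>,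
    which is not \<open>1\<close>, yet only permutes the residues; hence
    \<open>S = 0\<close>.\<close>
  have "e_mod M j * S = (\<Sum>n\<in>{1..int M}. e_mod M ((n + 1) * j))"
    by (simp add: S_def sum_distrib_left e_mod_add[symmetric] algebra_simps)
  also have "\<dots> = (\<Sum>n\<in>{2..int M + 1}. e_mod M (n * j))"
    by (rule sum.reindex_bij_witness[of _ "\<lambda>n. n - 1" "\<lambda>n. n + 1"]) auto
  also have "{2..int M + 1} = insert (int M + 1) {2..int M}" using assms by auto
  also have "(\<Sum>n\<in>\<dots>. e_mod M (n * j)) = e_mod M ((int M + 1) * j) + (\<Sum>n\<in>{2..int M}. e_mod M (n * j))"
    by (subst sum.insert) auto
  also have "e_mod M ((int M + 1) * j) = e_mod M (1 * j)"
    using assms by (intro e_mod_cong) (auto simp: algebra_simps)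
  also have "\<dots> + (\<Sum>n\<in>{2..int M}. e_mod M (n * j)) = (\<Sum>n\<in>insert 1 {2..int M}. e_mod M (n * j))"
    by (subst sum.insert) auto
  also have "insert 1 {2..int M} = {1..int M}" using assms by auto
  finally have "e_mod M j * S = S" unfolding S_def .
  then have "S = 0" using e_mod_eq_1_iff[OF assms] False by simp
  then show ?thesis using False by (simp add: S_def)
qed

lemma zmod_avg_e_mod:
  assumes "M > 0"
  shows "zmod_avg M (\<lambda>n. e_mod M (n * j)) = of_bool (int M dvd j)"
  using assms by (simp add: zmod_avg_def sum_e_mod)

section \<open>Finite Fourier series, Parseval and the \<open>U\<^sup>2\<close> norm\<close>

lemma zmod_avg_sum: "zmod_avg M (\<lambda>n. \<Sum>i\<in>I. f i n) = (\<Sum>i\<in>I. zmod_avg M (f i))"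
  unfolding zmod_avg_def by (subst sum.swap) (simp add: sum_divide_distrib)

lemma zmod_avg_cmult: "zmod_avg M (\<lambda>n. c * f n) = c * zmod_avg M f"
  by (simp add: zmod_avg_def sum_distrib_left)

lemma of_real_zmod_avg: "complex_of_real (zmod_avg M f) = zmod_avg M (\<lambda>n. of_real (f n))"
  by (simp add: zmod_avg_def)

lemma zmod_fourier_eq: "zmod_fourier M f \<xi> = zmod_avg M (\<lambda>n. f n * e_mod M (- (n * \<xi>)))"
  by (simp add: zmod_fourier_def e_mod_def)

text \<open>The inverse Fourier transform: an unnormalised sum, dual to the average in
  \<open>zmod_fourier\<close>. Functions are handled below through their coefficients
  \<open>c\<close>.\<close>

definition trig_sum :: "nat \<Rightarrow> (int \<Rightarrow> complex) \<Rightarrow> int \<Rightarrow> complex" where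
  "trig_sum M c n = (\<Sum>\<xi>\<in>{1..int M}. c \<xi> * e_mod M (n * \<xi>))"

text \<open>Orthogonality leaves only congruent frequencies, and congruent frequencies in
  \<open>{1..int M}\<close> are equal.\<close>

lemma parseval_trig_sum:
  assumes "M > 0"
  shows "zmod_avg M (\<lambda>n. trig_sum M a n * cnj (trig_sum M b n)) = (\<Sum>\<xi>\<in>{1..int M}. a \<xi> * cnj (b \<xi>))"
proof -
  have "trig_sum M a n * cnj (trig_sum M b n) =
      (\<Sum>\<xi>\<in>{1..int M}. \<Sum>\<eta>\<in>{1..int M}. (a \<xi> * cnj (b \<eta>)) * e_mod M (n * (\<xi> - \<eta>)))" for n
    unfolding trig_sum_def cnj_sum sum_product
    by (intro sum.cong refl) (simp add: right_diff_distrib e_mod_diff)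
  then have "zmod_avg M (\<lambda>n. trig_sum M a n * cnj (trig_sum M b n)) =
      (\<Sum>\<xi>\<in>{1..int M}. \<Sum>\<eta>\<in>{1..int M}. (a \<xi> * cnj (b \<eta>)) * of_bool (int M dvd \<xi> - \<eta>))"
    by (simp only: zmod_avg_sum zmod_avg_cmult zmod_avg_e_mod[OF assms])
  also have "\<dots> = (\<Sum>\<xi>\<in>{1..int M}. \<Sum>\<eta>\<in>{1..int M}. if \<eta> = \<xi> then a \<xi> * cnj (b \<eta>) else 0)"
  proof (intro sum.cong refl)
    fix \<xi> \<eta> assume *: "\<xi> \<in> {1..int M}" "\<eta> \<in> {1..int M}"
    have "int M dvd \<xi> - \<eta> \<longleftrightarrow> \<eta> = \<xi>"
    proof
      assume "int M dvd \<xi> - \<eta>"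
      moreover have "\<bar>\<xi> - \<eta>\<bar> < int M" using * by auto
      ultimately show "\<eta> = \<xi>" using dvd_imp_le_int[of "\<xi> - \<eta>" "int M"] by fastforce
    qed auto
    then show "a \<xi> * cnj (b \<eta>) * of_bool (int M dvd \<xi> - \<eta>) = (if \<eta> = \<xi> then a \<xi> * cnj (b \<eta>) else 0)" by simp
  qed
  also have "\<dots> = (\<Sum>\<xi>\<in>{1..int M}. a \<xi> * cnj (b \<xi>))" by (intro sum.cong refl) (simp add: sum.delta)
  finally show ?thesis .
qed

lemma periodic_mod_cong:
  assumes "periodic_mod M f" "int M dvd i - j"
  shows "f i = f j"
proof -
  have nat: "f (n + int M * int k) = f n" for n k
  proof (induction k)
    case (Suc k)
    have "f (n + int M * int (Suc k)) = f (n + int M * int k + int M)" by (simp add: algebra_simps)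
    then show ?case using assms(1) Suc.IH by (simp add: periodic_mod_def)
  qed simp
  obtain t where t: "i = j + int M * t" using assms(2) by (auto simp: dvd_def algebra_simps)
  show ?thesis
  proof (cases "t \<ge> 0")
    case True
    then show ?thesis using nat[of j "nat t"] t by simp
  next
    case False
    then show ?thesis using nat[of i "nat (- t)"] t by simp
  qed
qed

lemma fourier_inversion:
  assumes "M > 0" "periodic_mod M f"
  shows "trig_sum M (zmod_fourier M f) n = f n"
proof -
  have "trig_sum M (zmod_fourier M f) n = (\<Sum>\<xi>\<in>{1..int M}. zmod_avg M (\<lambda>k. f k * e_mod M ((n - k) * \<xi>)))"
    unfolding trig_sum_def zmod_fourier_eq zmod_avg_def sum_divide_distrib sum_distrib_right
    by (intro sum.cong refl) (simp add: left_diff_distrib e_mod_diff)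
  also have "\<dots> = zmod_avg M (\<lambda>k. f k * (\<Sum>\<xi>\<in>{1..int M}. e_mod M (\<xi> * (n - k))))"
    by (simp only: zmod_avg_sum[symmetric] sum_distrib_left mult.commute[of "n - _"])
  also have "\<dots> = (\<Sum>k\<in>{1..int M}. f k * of_bool (int M dvd n - k))"
    using assms(1) by (simp add: sum_e_mod zmod_avg_def sum_divide_distrib)
  \<comment> \<open>The index \<open>(n - 1) mod int M + 1\<close> is the representative of
    \<open>n\<close> in \<open>{1..int M}\<close>; a plain remainder would give \<open>0\<close>
    instead of \<open>M\<close>.\<close>
  also have "\<dots> = (\<Sum>k\<in>{1..int M}. if k = (n - 1) mod int M + 1 then f n else 0)"
  proof (intro sum.cong refl)
    fix k assume k: "k \<in> {1..int M}"
    have "int M dvd n - k \<longleftrightarrow> (n - 1) mod int M = (k - 1) mod int M"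
      by (simp add: mod_eq_dvd_iff)
    also have "(k - 1) mod int M = k - 1" using k by simp
    finally show "f k * of_bool (int M dvd n - k) = (if k = (n - 1) mod int M + 1 then f n else 0)"
      using periodic_mod_cong[OF assms(2), of n k] by auto
  qed
  also have "\<dots> = f n"
  proof -
    have "0 \<le> (n - 1) mod int M" "(n - 1) mod int M < int M" using assms(1) by auto
    then have "(n - 1) mod int M + 1 \<in> {1..int M}" unfolding atLeastAtMost_iff by linarith
    then show ?thesis by (subst sum.delta) (simp_all only: finite_atLeastAtMost_int if_True)
  qed
  finally show ?thesis .
qed

lemma zmod_conv_eq_trig_sum:
  assumes "M > 0" "periodic_mod M \<psi>"
  shows "zmod_conv M f \<psi> n = trig_sum M (\<lambda>\<xi>. zmod_fourier M f \<xi> * zmod_fourier M \<psi> \<xi>) n"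
proof -
  have "zmod_conv M f \<psi> n = zmod_avg M (\<lambda>k. trig_sum M (zmod_fourier M \<psi>) (n - k) * f k)"
    by (simp add: zmod_conv_def fourier_inversion assms)
  also have "\<dots> = zmod_avg M (\<lambda>k. \<Sum>\<xi>\<in>{1..int M}. (zmod_fourier M \<psi> \<xi> * e_mod M (n * \<xi>)) * (f k * e_mod M (- (k * \<xi>))))"
    unfolding trig_sum_def sum_distrib_right left_diff_distrib e_mod_diff by (simp only: mult_ac)
  also have "\<dots> = (\<Sum>\<xi>\<in>{1..int M}. (zmod_fourier M \<psi> \<xi> * e_mod M (n * \<xi>)) * zmod_fourier M f \<xi>)"
    by (simp only: zmod_avg_sum zmod_avg_cmult zmod_fourier_eq)
  finally show ?thesis by (simp add: trig_sum_def mult_ac)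
qed

lemma plancherel:
  assumes "M > 0" "periodic_mod M f"
  shows "(\<Sum>\<xi>\<in>{1..int M}. (norm (zmod_fourier M f \<xi>))\<^sup>2) = zmod_avg M (\<lambda>n. (norm (f n))\<^sup>2)"
proof -
  have "complex_of_real (\<Sum>\<xi>\<in>{1..int M}. (norm (zmod_fourier M f \<xi>))\<^sup>2) = of_real (zmod_avg M (\<lambda>n. (norm (f n))\<^sup>2))"
    unfolding of_real_zmod_avg of_real_sum complex_norm_square
    using parseval_trig_sum[OF assms(1), of "zmod_fourier M f" "zmod_fourier M f"]
    by (simp add: fourier_inversion assms)
  then show ?thesis by (simp only: of_real_eq_iff)
qed

text \<open>The autocorrelation at shift \<open>h\<close> is again a trigonometric sum in
  \<open>h\<close>, with coefficients \<open>c \<xi> * cnj (c \<xi>)\<close>. A second use of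
  Parseval produces the fourth powers.\<close>

lemma U2_norm_trig_sum:
  assumes "M > 0"
  shows "U2_norm M (trig_sum M c) = root 4 (\<Sum>\<xi>\<in>{1..int M}. (norm (c \<xi>)) ^ 4)"
proof -
  have shift: "trig_sum M c (n + h) = trig_sum M (\<lambda>\<xi>. c \<xi> * e_mod M (h * \<xi>)) n" for n h
    unfolding trig_sum_def distrib_right e_mod_add by (simp only: mult_ac)
  have corr: "zmod_avg M (\<lambda>n. trig_sum M c (n + h) * cnj (trig_sum M c n)) = trig_sum M (\<lambda>\<xi>. c \<xi> * cnj (c \<xi>)) h" for h
    unfolding shift parseval_trig_sum[OF assms] by (simp add: trig_sum_def mult_ac)
  have "complex_of_real (zmod_avg M (\<lambda>h. (norm (trig_sum M (\<lambda>\<xi>. c \<xi> * cnj (c \<xi>)) h))\<^sup>2)) =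
      of_real (\<Sum>\<xi>\<in>{1..int M}. (norm (c \<xi>)) ^ 4)"
    unfolding of_real_zmod_avg complex_norm_square parseval_trig_sum[OF assms]
    by (simp add: power4_eq_xxxx power2_eq_square mult.assoc flip: complex_norm_square)
  then show ?thesis unfolding U2_norm_def corr by (simp only: of_real_eq_iff)
qed

text \<open>Of each fourth power, one square is bounded uniformly by \<open>\<delta> ^ 4\<close> and
  the other is summed.\<close>

lemma U2_norm_trig_sum_le:
  assumes "M > 0" "\<delta> \<ge> 0" and small: "\<And>\<xi>. norm (c \<xi>) \<le> \<delta>\<^sup>2"
    and l2: "(\<Sum>\<xi>\<in>{1..int M}. (norm (c \<xi>))\<^sup>2) \<le> 1"
  shows "U2_norm M (trig_sum M c) \<le> \<delta>"
proof -
  have "(\<Sum>\<xi>\<in>{1..int M}. (norm (c \<xi>)) ^ 4) \<le> (\<Sum>\<xi>\<in>{1..int M}. \<delta> ^ 4 * (norm (c \<xi>))\<^sup>2)"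
  proof (rule sum_mono)
    fix \<xi>
    have "(norm (c \<xi>))\<^sup>2 \<le> (\<delta>\<^sup>2)\<^sup>2" using small by (intro power_mono) auto
    then have "(norm (c \<xi>))\<^sup>2 * (norm (c \<xi>))\<^sup>2 \<le> (\<delta>\<^sup>2)\<^sup>2 * (norm (c \<xi>))\<^sup>2" by (intro mult_right_mono) auto
    then show "(norm (c \<xi>)) ^ 4 \<le> \<delta> ^ 4 * (norm (c \<xi>))\<^sup>2" by (simp flip: power_add power_mult)
  qed
  also have "\<dots> \<le> \<delta> ^ 4"
    using l2 mult_left_mono[OF l2, of "\<delta> ^ 4"] by (simp add: sum_distrib_left)
  finally have "root 4 (\<Sum>\<xi>\<in>{1..int M}. (norm (c \<xi>)) ^ 4) \<le> root 4 (\<delta> ^ 4)" by simp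
  then show ?thesis using assms by (simp add: U2_norm_trig_sum real_root_power_cancel)
qed


subsection \<open>The dilated Fejer kernel\<close>

lemma exists_abs_least_residue:
  assumes "M > 0"
  obtains d where "int M dvd a - d" "2 * \<bar>d\<bar> \<le> int M"
proof -
  define r where "r = a mod int M"
  have r: "0 \<le> r" "r < int M" using assms by (simp_all add: r_def)
  have "int M dvd a - r" by (simp add: r_def minus_mod_eq_mult_div)
  moreover from dvd_add[OF this dvd_refl] have "int M dvd a - (r - int M)" by (simp add: algebra_simps)
  moreover have "2 * \<bar>r\<bar> \<le> int M \<or> 2 * \<bar>r - int M\<bar> \<le> int M" using r by (auto simp: abs_if)
  ultimately show ?thesis using that by blast
qed

text \<open>Distinct congruent integers differ by at least \<open>M\<close>, so if \<open>d\<close>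
  is at most half of \<open>M\<close> in size, \<open>e\<close> is at least half.\<close>

lemma abs_least_residue_le:
  fixes d e :: int
  assumes "2 * \<bar>d\<bar> \<le> int M" "int M dvd d - e"
  shows "\<bar>d\<bar> \<le> \<bar>e\<bar>"
proof (cases "d = e")
  case False
  then have "int M \<le> \<bar>d - e\<bar>" using dvd_imp_le_int[OF _ assms(2)] by simp
  then show ?thesis using assms(1) by linarith
qed simp

text \<open>The parameter \<open>s\<close> is an inverse of \<open>Q\<close> modulo \<open>M\<close>; \<open>fejer_coeff\<close> is evaluated at \<open>Q * \<xi>\<close>.\<close>

definition fejer :: "nat \<Rightarrow> nat \<Rightarrow> int \<Rightarrow> int \<Rightarrow> real" where
  "fejer M m s n = (norm (\<Sum>i<m. e_mod M (n * (s * int i))))\<^sup>2 / m"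

definition fejer_coeff :: "nat \<Rightarrow> nat \<Rightarrow> int \<Rightarrow> real" where
  "fejer_coeff M m \<eta> = (\<Sum>i<m. \<Sum>j<m. of_bool (int M dvd \<eta> - (int i - int j))) / m"

lemma fejer_eq_sum:
  "complex_of_real (fejer M m s n) = (\<Sum>i<m. \<Sum>j<m. e_mod M (n * (s * (int i - int j)))) / m"
  unfolding fejer_def of_real_divide complex_norm_square cnj_sum sum_product
  by (simp add: right_diff_distrib e_mod_diff)

lemma fejer_0: "fejer M m s 0 = m"
  by (cases "m = 0") (auto simp: fejer_def power2_eq_square)

lemma periodic_fejer:
  assumes "M > 0"
  shows "periodic_mod M (fejer M m s)"
proof -
  have "e_mod M ((n + int M) * (s * int i)) = e_mod M (n * (s * int i))" for n i
    using assms by (intro e_mod_cong) (auto simp: algebra_simps)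
  then show ?thesis by (simp add: periodic_mod_def fejer_def)
qed

text \<open>The expanded kernel has the frequencies \<open>s * (i - j)\<close>. Its coefficient at
  \<open>\<xi>\<close> counts the pairs with \<open>s * (i - j)\<close> congruent to
  \<open>\<xi>\<close>, equivalently with \<open>i - j\<close> congruent to
  \<open>Q * \<xi>\<close>.\<close>

lemma fourier_fejer:
  assumes "M > 0" and s: "int M dvd s * Q - 1"
  shows "zmod_fourier M (\<lambda>n. complex_of_real (fejer M m s n)) \<xi> = of_real (fejer_coeff M m (Q * \<xi>))"
proof -
  \<comment> \<open>Multiplication by \<open>Q\<close> carries the first congruence to the second,
    and multiplication by \<open>s\<close> carries it back.\<close>
  have dvd: "int M dvd s * k - \<xi> \<longleftrightarrow> int M dvd Q * \<xi> - k" for k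
  proof -
    obtain t where t: "s * Q = 1 + int M * t" using s by (auto simp: dvd_def algebra_simps)
    have 1: "Q * (s * k - \<xi>) = int M * (t * k) - (Q * \<xi> - k)"
      using arg_cong[OF t, of "\<lambda>x. x * k"] by (simp add: algebra_simps)
    have 2: "s * (Q * \<xi> - k) = int M * (t * \<xi>) - (s * k - \<xi>)"
      using arg_cong[OF t, of "\<lambda>x. x * \<xi>"] by (simp add: algebra_simps)
    show ?thesis
    proof
      assume "int M dvd s * k - \<xi>"
      then have "int M dvd int M * (t * k) - (Q * \<xi> - k)" using 1 by (metis dvd_mult)
      then show "int M dvd Q * \<xi> - k" by (simp add: dvd_diff_right_iff)
    next
      assume "int M dvd Q * \<xi> - k"
      then have "int M dvd int M * (t * \<xi>) - (s * k - \<xi>)" using 2 by (metis dvd_mult)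
      then show "int M dvd s * k - \<xi>" by (simp add: dvd_diff_right_iff)
    qed
  qed
  have "zmod_fourier M (\<lambda>n. complex_of_real (fejer M m s n)) \<xi> =
      zmod_avg M (\<lambda>n. (1 / of_nat m) * (\<Sum>i<m. \<Sum>j<m. e_mod M (n * (s * (int i - int j) - \<xi>))))"
    unfolding zmod_fourier_eq fejer_eq_sum right_diff_distrib[of _ "s * (_ - _)" \<xi>] e_mod_diff[of _ "_ * (s * _)"]
    by (simp add: sum_distrib_right)
  also have "\<dots> = of_real (fejer_coeff M m (Q * \<xi>))"
    unfolding zmod_avg_cmult zmod_avg_sum zmod_avg_e_mod[OF assms(1)] dvd
    by (simp add: fejer_coeff_def)
  finally show ?thesis .
qed

text \<open>Each admissible \<open>i\<close> determines \<open>j\<close>, and the admissible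
  \<open>i\<close> form an interval: this is the triangle function.\<close>

lemma card_diff_eq: "(\<Sum>i<m. \<Sum>j<m. of_bool (d = int i - int j)) = max 0 (real m - \<bar>of_int d\<bar>)"
proof -
  have "(\<Sum>j<m. of_bool (d = int i - int j)) = (of_bool (d \<le> int i \<and> int i < int m + d) :: real)" for i
  proof -
    have "(\<Sum>j<m. of_bool (d = int i - int j)) = (\<Sum>j<m. if j = nat (int i - d) \<and> d \<le> int i then 1 else 0 :: real)"
      by (intro sum.cong) auto
    also have "\<dots> = of_bool (d \<le> int i \<and> int i < int m + d)"
      by (cases "d \<le> int i") (auto simp: sum.delta)
    finally show ?thesis .
  qed
  then have "(\<Sum>i<m. \<Sum>j<m. of_bool (d = int i - int j)) = real (card {i. i < m \<and> d \<le> int i \<and> int i < int m + d})"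
    by (simp add: Int_def)
  also have "{i. i < m \<and> d \<le> int i \<and> int i < int m + d} = {nat d..<nat (min (int m) (int m + d))}"
    by auto
  also have "real (card \<dots>) = max 0 (real m - \<bar>of_int d\<bar>)" by auto
  finally show ?thesis .
qed

text \<open>As \<open>\<bar>i - j\<bar> < m \<le> M / 2\<close> and
  \<open>\<bar>d\<bar> \<le> M / 2\<close>, congruence of \<open>d\<close> and \<open>i - j\<close>
  is equality, so nothing wraps around.\<close>

lemma fejer_coeff_eq:
  assumes "m > 0" "2 * m \<le> M" and d: "2 * \<bar>d\<bar> \<le> int M" "int M dvd \<eta> - d"
  shows "fejer_coeff M m \<eta> = max 0 (1 - \<bar>of_int d\<bar> / m)"
proof -
  have "int M dvd \<eta> - (int i - int j) \<longleftrightarrow> d = int i - int j" if ij: "i < m" "j < m" for i j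
  proof
    assume "int M dvd \<eta> - (int i - int j)"
    then have "int M dvd (\<eta> - (int i - int j)) - (\<eta> - d)" using d(2) by (rule dvd_diff)
    then have dvd: "int M dvd d - (int i - int j)" by (simp add: algebra_simps)
    have "\<bar>d - (int i - int j)\<bar> < int M" using ij d(1) assms(2) by linarith
    then show "d = int i - int j" using dvd dvd_imp_le_int[OF _ dvd] by fastforce
  qed (use d in simp)
  then have "fejer_coeff M m \<eta> = (\<Sum>i<m. \<Sum>j<m. of_bool (d = int i - int j)) / m"
    by (simp add: fejer_coeff_def)
  also have "\<dots> = max 0 (1 - \<bar>of_int d\<bar> / m)"
    unfolding card_diff_eq using assms(1) by (auto simp: max_def field_simps)
  finally show ?thesis .
qed

subsection \<open>The decomposition\<close>

lemma periodic_truncate_mod: "periodic_mod M (truncate_mod M N chi)"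
  by (simp add: periodic_mod_def truncate_mod_def)

lemma norm_truncate_mod_le:
  assumes "chi \<in> unimodular_cmult"
  shows "norm (truncate_mod M N chi n) \<le> 1"
  using assms by (simp add: truncate_mod_def unimodular_cmult_def Let_def)

lemma fourier_truncate_mod:
  assumes "N < M"
  shows "zmod_fourier M (truncate_mod M N chi) \<xi> = (\<Sum>n\<in>{1..N}. chi n * e_mod M (- \<xi>) ^ n) / M"
proof -
  have 1: "{1..int M} = int ` {1..M}" by (simp add: image_int_atLeastAtMost)
  have "(\<Sum>n\<in>{1..int M}. truncate_mod M N chi n * e_mod M (- (n * \<xi>))) =
      (\<Sum>n\<in>{1..M}. truncate_mod M N chi (int n) * e_mod M (- \<xi>) ^ n)"
    unfolding 1 by (subst sum.reindex) (auto simp: e_mod_power)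
  also have "\<dots> = (\<Sum>n\<in>{1..N}. truncate_mod M N chi (int n) * e_mod M (- \<xi>) ^ n)"
  proof (rule sum.mono_neutral_right)
    show "\<forall>n\<in>{1..M} - {1..N}. truncate_mod M N chi (int n) * e_mod M (- \<xi>) ^ n = 0"
    proof
      fix n assume "n \<in> {1..M} - {1..N}"
      then have n: "N < n" "n \<le> M" by auto
      \<comment> \<open>At \<open>n = M\<close> the residue is \<open>0\<close>, which receives the
        value \<open>0\<close>; any other \<open>n\<close> here is its own residue and exceeds
        \<open>N\<close>.\<close>
      show "truncate_mod M N chi (int n) * e_mod M (- \<xi>) ^ n = 0"
        using n by (cases "n = M") (auto simp: truncate_mod_def)
    qed
  qed (use assms in auto)
  also have "\<dots> = (\<Sum>n\<in>{1..N}. chi n * e_mod M (- \<xi>) ^ n)"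
    using assms by (intro sum.cong) (auto simp: truncate_mod_def)
  finally show ?thesis by (simp add: zmod_fourier_eq zmod_avg_def)
qed

lemma norm_unimodular_sum_le:
  assumes "chi \<in> unimodular_cmult" "norm z = 1"
  shows "norm (\<Sum>n\<in>{1..N}. chi n * z ^ n) \<le> N"
proof -
  have "norm (\<Sum>n\<in>{1..N}. chi n * z ^ n) \<le> (\<Sum>n\<in>{1..N}. norm (chi n * z ^ n))" by (rule norm_sum)
  also have "\<dots> = (\<Sum>n\<in>{1..N}. 1)"
    using assms by (intro sum.cong) (auto simp: norm_mult norm_power unimodular_cmult_def)
  finally show ?thesis by simp
qed

lemma norm_fourier_truncate_mod_le:
  assumes "chi \<in> unimodular_cmult" "N < M"
  shows "norm (zmod_fourier M (truncate_mod M N chi) \<xi>) \<le> 1"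
  using norm_unimodular_sum_le[OF assms(1), of "e_mod M (- \<xi>)" N] assms(2)
  by (simp add: fourier_truncate_mod norm_divide)

section \<open>Bounds and monotonicity of the Fejer coefficients\<close>

lemma fejer_coeff_nonneg: "0 \<le> fejer_coeff M m \<eta>"
  by (simp add: fejer_coeff_def sum_nonneg)

lemma fejer_coeff_le_1:
  assumes "m > 0" "2 * m \<le> M"
  shows "fejer_coeff M m \<eta> \<le> 1"
proof -
  obtain d where "int M dvd \<eta> - d" "2 * \<bar>d\<bar> \<le> int M" using exists_abs_least_residue[of M \<eta>] assms by auto
  then show ?thesis using fejer_coeff_eq[OF assms] by simp
qed

text \<open>Multiplying by \<open>t\<close> enlarges the distance to the multiples of
  \<open>M\<close> at most \<open>t\<close> times, while the width grows at least \<open>t\<close>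
  times, so the ratio of the two does not increase.\<close>

lemma fejer_coeff_mult_le:
  assumes "m > 0" "2 * m \<le> M" "m' > 0" "2 * m' \<le> M" "t * m \<le> m'"
  shows "fejer_coeff M m \<eta> \<le> fejer_coeff M m' (int t * \<eta>)"
proof -
  obtain d where d: "int M dvd \<eta> - d" "2 * \<bar>d\<bar> \<le> int M"
    using exists_abs_least_residue[of M \<eta>] assms by auto
  obtain d' where d': "int M dvd int t * \<eta> - d'" "2 * \<bar>d'\<bar> \<le> int M"
    using exists_abs_least_residue[of M "int t * \<eta>"] assms by auto
  have "int M dvd int t * (\<eta> - d)" using d(1) by simp
  then have "int M dvd int t * (\<eta> - d) - (int t * \<eta> - d')" using d'(1) by (rule dvd_diff)
  then have "int M dvd d' - int t * d" by (simp add: algebra_simps)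
  then have "\<bar>d'\<bar> \<le> int t * \<bar>d\<bar>" using abs_least_residue_le[OF d'(2), of "int t * d"] by (simp add: abs_mult)
  then have "real_of_int (\<bar>d'\<bar> * int m) \<le> real_of_int (int t * \<bar>d\<bar> * int m)"
    by (simp only: of_int_le_iff mult_right_mono of_nat_0_le_iff)
  also have "\<dots> = \<bar>of_int d\<bar> * real (t * m)" by simp
  also have "\<dots> \<le> \<bar>of_int d\<bar> * real m'" using assms(5) by (intro mult_left_mono of_nat_mono) auto
  finally have "\<bar>of_int d'\<bar> / real m' \<le> \<bar>of_int d\<bar> / real m" using assms by (simp add: field_simps)
  then show ?thesis
    using d d' assms by (simp add: fejer_coeff_eq[where d = d] fejer_coeff_eq[where d = d'])
qed

text \<open>Where the coefficient is nonzero, the least residue is at most \<open>m\<close> in size,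
  and \<open>2 * pi \<le> 7\<close>. Keeping the coefficient as a factor covers the remaining
  frequencies.\<close>

lemma fejer_coeff_mult_norm_le:
  assumes "m > 0" "2 * m \<le> M"
  shows "fejer_coeff M m \<eta> * norm (e_mod M \<eta> - 1) \<le> fejer_coeff M m \<eta> * (7 * m / M)"
proof -
  obtain d where d: "int M dvd \<eta> - d" "2 * \<bar>d\<bar> \<le> int M"
    using exists_abs_least_residue[of M \<eta>] assms by auto
  have "norm (e_mod M \<eta> - 1) = norm (e_mod M d - 1)" using e_mod_cong[OF _ d(1)] assms by simp
  also have "\<dots> \<le> 2 * pi * \<bar>of_int d\<bar> / M" by (rule norm_e_mod_diff_1_le)
  also have "\<dots> \<le> 7 * \<bar>of_int d\<bar> / M" using pi_approx by (intro divide_right_mono mult_right_mono) auto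
  finally have *: "norm (e_mod M \<eta> - 1) \<le> 7 * \<bar>of_int d\<bar> / M" .
  show ?thesis
  proof (cases "\<bar>real_of_int d\<bar> \<le> m")
    case True
    then have "7 * \<bar>of_int d\<bar> / M \<le> 7 * m / M" by (intro divide_right_mono mult_left_mono) auto
    then show ?thesis using * by (intro mult_left_mono fejer_coeff_nonneg) linarith
  next
    case False
    then have "fejer_coeff M m \<eta> = 0" using d assms by (simp add: fejer_coeff_eq[where d = d] max_def field_simps)
    then show ?thesis by simp
  qed
qed

text \<open>The average is the Fourier coefficient at \<open>0\<close>, the peak \<open>1\<close> of
  the triangle.\<close>

lemma zmod_kernel_fejer:
  assumes "M > 0" "m > 0" "2 * m \<le> M" "int M dvd s * Q - 1"
  shows "zmod_kernel M (fejer M m s)"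
proof -
  have "complex_of_real (zmod_avg M (fejer M m s)) = zmod_fourier M (\<lambda>n. of_real (fejer M m s n)) 0"
    by (simp add: of_real_zmod_avg zmod_fourier_eq)
  also have "\<dots> = 1" using assms by (simp add: fourier_fejer fejer_coeff_eq[where d = 0])
  finally show ?thesis using assms periodic_fejer by (simp add: zmod_kernel_def fejer_def)
qed

text \<open>By inversion the coefficients add up to the value of the kernel at
  \<open>0\<close>.\<close>

lemma sum_fejer_coeff:
  assumes "M > 0" "int M dvd s * Q - 1"
  shows "(\<Sum>\<xi>\<in>{1..int M}. fejer_coeff M m (Q * \<xi>)) = m"
proof -
  have "periodic_mod M (\<lambda>n. complex_of_real (fejer M m s n))"
    using periodic_fejer[OF assms(1)] by (simp add: periodic_mod_def)
  from fourier_inversion[OF assms(1) this, of 0]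
  have "complex_of_real (\<Sum>\<xi>\<in>{1..int M}. fejer_coeff M m (Q * \<xi>)) = of_nat m"
    by (simp add: trig_sum_def fourier_fejer[OF assms] fejer_0)
  then show ?thesis by (metis of_real_eq_iff of_real_of_nat_eq)
qed

section \<open>Structured and uniform parts for the Fejer kernel\<close>

lemma structured_part_fejer:
  assumes "M > 0" "int M dvd s * Q - 1"
  shows "structured_part M N (fejer M m s) chi =
    trig_sum M (\<lambda>\<xi>. zmod_fourier M (truncate_mod M N chi) \<xi> * of_real (fejer_coeff M m (Q * \<xi>)))"
proof -
  have "periodic_mod M (\<lambda>n. complex_of_real (fejer M m s n))"
    using periodic_fejer[OF assms(1)] by (simp add: periodic_mod_def)
  then show ?thesis
    using assms by (simp add: fun_eq_iff structured_part_def zmod_conv_eq_trig_sum fourier_fejer)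
qed

text \<open>A shift by \<open>Q\<close> multiplies the term at \<open>\<xi>\<close> by
  \<open>e_mod M (Q * \<xi>)\<close>, which is within \<open>7 * m / M\<close> of \<open>1\<close>
  wherever the Fejer coefficient is nonzero. These coefficients total \<open>m\<close>.\<close>

lemma structured_part_almost_periodic:
  assumes "N < M" "m > 0" "2 * m \<le> M" "int M dvd s * Q - 1" "chi \<in> unimodular_cmult"
  shows "norm (structured_part M N (fejer M m s) chi (n + Q) - structured_part M N (fejer M m s) chi n)
           \<le> 7 * (real m)\<^sup>2 / M"
proof -
  define c where "c \<xi> = zmod_fourier M (truncate_mod M N chi) \<xi>" for \<xi>
  define w where "w \<xi> = fejer_coeff M m (Q * \<xi>)" for \<xi>
  have w0: "w \<xi> \<ge> 0" for \<xi> by (simp add: w_def fejer_coeff_nonneg)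
  have "structured_part M N (fejer M m s) chi (n + Q) - structured_part M N (fejer M m s) chi n =
      (\<Sum>\<xi>\<in>{1..int M}. c \<xi> * of_real (w \<xi>) * e_mod M (n * \<xi>) * (e_mod M (Q * \<xi>) - 1))"
    using assms
    by (simp add: structured_part_fejer trig_sum_def c_def w_def distrib_right e_mod_add
        right_diff_distrib sum_subtractf mult.assoc)
  also have "norm \<dots> \<le> (\<Sum>\<xi>\<in>{1..int M}. norm (c \<xi> * of_real (w \<xi>) * e_mod M (n * \<xi>) * (e_mod M (Q * \<xi>) - 1)))"
    by (rule norm_sum)
  also have "\<dots> \<le> (\<Sum>\<xi>\<in>{1..int M}. w \<xi> * (7 * m / M))"
  proof (rule sum_mono)
    fix \<xi>
    have "norm (c \<xi> * of_real (w \<xi>) * e_mod M (n * \<xi>) * (e_mod M (Q * \<xi>) - 1)) =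
        norm (c \<xi>) * (w \<xi> * norm (e_mod M (Q * \<xi>) - 1))"
      using w0 by (simp add: norm_mult)
    also have "\<dots> \<le> 1 * (w \<xi> * norm (e_mod M (Q * \<xi>) - 1))"
      using w0 assms by (intro mult_right_mono) (auto simp: c_def norm_fourier_truncate_mod_le)
    also have "\<dots> \<le> w \<xi> * (7 * m / M)"
      using fejer_coeff_mult_norm_le[OF assms(2,3)] by (simp add: w_def)
    finally show "norm (c \<xi> * of_real (w \<xi>) * e_mod M (n * \<xi>) * (e_mod M (Q * \<xi>) - 1)) \<le> w \<xi> * (7 * m / M)" .
  qed
  also have "\<dots> = 7 * (real m)\<^sup>2 / M"
    using sum_fejer_coeff[of M s Q m] assms by (simp add: w_def power2_eq_square flip: sum_distrib_right sum_divide_distrib)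
  finally show ?thesis .
qed

text \<open>Either the Fourier coefficient is at most \<open>\<delta>\<close>, or the exponential
  sum is large; then \<open>Q * \<xi>\<close> is within \<open>\<delta> * m\<close> of a multiple of
  \<open>M\<close> and the Fejer coefficient is at least \<open>1 - \<delta>\<close>.\<close>

lemma uniform_part_coefficient_le:
  assumes "N < M" "m > 0" "2 * m \<le> M" "chi \<in> unimodular_cmult" "\<delta> > 0"
    and major: "\<And>z. norm z = 1 \<Longrightarrow> \<delta> * N \<le> norm (\<Sum>n\<in>{1..N}. chi n * z ^ n) \<Longrightarrow>
                  norm (1 - z ^ Q) * N \<le> \<delta>\<^sup>2 * m"
  shows "norm (zmod_fourier M (truncate_mod M N chi) \<xi>) * (1 - fejer_coeff M m (int Q * \<xi>)) \<le> \<delta>"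
proof (cases "norm (zmod_fourier M (truncate_mod M N chi) \<xi>) \<le> \<delta>")
  case True
  then show ?thesis
    using fejer_coeff_nonneg fejer_coeff_le_1[OF assms(2,3)] assms(5)
      mult_mono[of "norm (zmod_fourier M (truncate_mod M N chi) \<xi>)" \<delta> "1 - fejer_coeff M m (int Q * \<xi>)" 1]
    by simp
next
  case False
  define z where "z = e_mod M (- \<xi>)"
  define S where "S = norm (\<Sum>n\<in>{1..N}. chi n * z ^ n)"
  have "\<delta> * M < S"
    using False assms(1) by (simp add: fourier_truncate_mod norm_divide z_def S_def field_simps)
  moreover have "S \<le> N" unfolding S_def z_def using assms(4) by (intro norm_unimodular_sum_le) auto
  moreover have "\<delta> * N \<le> \<delta> * M" using assms by simp
  \<comment> \<open>A large coefficient forces \<open>N\<close> to be comparable with \<open>M\<close>, so no upper bound on the prime \<open>M\<close>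
    in terms of \<open>N\<close> is ever needed.\<close>
  ultimately have N: "\<delta> * M \<le> N" and "\<delta> * N \<le> S" by linarith+
  then have "norm (1 - z ^ Q) * N \<le> \<delta>\<^sup>2 * m" using major[of z] by (simp add: z_def S_def)
  moreover have "norm (1 - z ^ Q) * (\<delta> * M) \<le> norm (1 - z ^ Q) * N" using N by (intro mult_left_mono) auto
  \<comment> \<open>Of the two factors \<open>\<delta>\<close> in the bound from
    \<open>major\<close>, one pays for replacing \<open>N\<close> by
    \<open>\<delta> * M\<close>.\<close>
  ultimately have "\<delta> * (norm (1 - z ^ Q) * M) \<le> \<delta> * (\<delta> * m)" by (simp add: power2_eq_square mult_ac)
  then have small: "M * norm (1 - z ^ Q) \<le> \<delta> * m" using assms(5) by (simp add: mult.commute)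
  obtain d where d: "int M dvd int Q * \<xi> - d" "2 * \<bar>d\<bar> \<le> int M"
    using exists_abs_least_residue[of M "int Q * \<xi>"] assms by auto
  \<comment> \<open>Conjugation turns the frequency \<open>- Q * \<xi>\<close> into
    \<open>Q * \<xi>\<close> and preserves the distance to \<open>1\<close>.\<close>
  have "cnj (z ^ Q) = e_mod M d"
    using e_mod_cong[OF _ d(1)] assms by (simp add: z_def e_mod_power)
  then have "norm (1 - z ^ Q) = norm (e_mod M d - 1)"
    by (metis complex_cnj_diff complex_cnj_one complex_mod_cnj norm_minus_commute)
  then have "\<bar>of_int d\<bar> \<le> \<delta> * m" using norm_e_mod_diff_1_ge[OF d(2)] small by simp
  then have "\<bar>of_int d\<bar> / m \<le> \<delta>" using assms(2) by (simp add: field_simps)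
  then have "1 - fejer_coeff M m (int Q * \<xi>) \<le> \<delta>"
    using fejer_coeff_eq[OF assms(2,3) d(2,1)] by linarith
  then show ?thesis
    using mult_mono[of "norm (zmod_fourier M (truncate_mod M N chi) \<xi>)" 1 "1 - fejer_coeff M m (int Q * \<xi>)" \<delta>]
      norm_fourier_truncate_mod_le[OF assms(4,1)] fejer_coeff_le_1[OF assms(2,3)] by simp
qed

text \<open>The coefficients \<open>c\<close> are uniformly at most \<open>\<delta>\<^sup>2\<close>
  by the dichotomy above, used with \<open>\<delta>\<^sup>2\<close> for \<open>\<delta>\<close>. By
  Plancherel their squares sum to at most \<open>1\<close>.\<close>

lemma U2_norm_uniform_part_le:
  assumes "N < M" "m > 0" "2 * m \<le> M" "int M dvd s * int Q - 1" "chi \<in> unimodular_cmult" "\<delta> > 0"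
    and major: "\<And>z. norm z = 1 \<Longrightarrow> \<delta>\<^sup>2 * N \<le> norm (\<Sum>n\<in>{1..N}. chi n * z ^ n) \<Longrightarrow>
                  norm (1 - z ^ Q) * N \<le> \<delta> ^ 4 * m"
  shows "U2_norm M (uniform_part M N (fejer M m s) chi) \<le> \<delta>"
proof -
  have M: "M > 0" using assms by simp
  define f where "f = zmod_fourier M (truncate_mod M N chi)"
  define c where "c \<xi> = f \<xi> * of_real (1 - fejer_coeff M m (int Q * \<xi>))" for \<xi>
  have norm_c: "norm (c \<xi>) = norm (f \<xi>) * (1 - fejer_coeff M m (int Q * \<xi>))" for \<xi>
    using fejer_coeff_le_1[OF assms(2,3)] by (simp add: c_def norm_mult del: of_real_diff)
  have "uniform_part M N (fejer M m s) chi = trig_sum M c"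
  proof
    fix n
    have "uniform_part M N (fejer M m s) chi n = trig_sum M f n -
        trig_sum M (\<lambda>\<xi>. f \<xi> * of_real (fejer_coeff M m (int Q * \<xi>))) n"
      by (simp add: uniform_part_def structured_part_fejer[OF M assms(4)] f_def
          fourier_inversion[OF M periodic_truncate_mod])
    then show "uniform_part M N (fejer M m s) chi n = trig_sum M c n"
      by (simp add: trig_sum_def c_def sum_subtractf algebra_simps)
  qed
  moreover have "U2_norm M (trig_sum M c) \<le> \<delta>"
  proof (rule U2_norm_trig_sum_le)
    show "norm (c \<xi>) \<le> \<delta>\<^sup>2" for \<xi>
      unfolding norm_c f_def using assms(1-3,5,6) major
      by (intro uniform_part_coefficient_le) (auto simp flip: power_mult)
    have "(\<Sum>\<xi>\<in>{1..int M}. (norm (c \<xi>))\<^sup>2) \<le> (\<Sum>\<xi>\<in>{1..int M}. (norm (f \<xi>))\<^sup>2)"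
    proof (intro sum_mono power_mono)
      show "norm (c \<xi>) \<le> norm (f \<xi>)" for \<xi>
        unfolding norm_c using fejer_coeff_nonneg[of M m "int Q * \<xi>"] by (simp add: mult_left_le)
    qed simp
    also have "\<dots> = zmod_avg M (\<lambda>n. (norm (truncate_mod M N chi n))\<^sup>2)"
      unfolding f_def by (rule plancherel[OF M periodic_truncate_mod])
    also have "\<dots> \<le> 1"
    proof -
      have "(\<Sum>n\<in>{1..int M}. (norm (truncate_mod M N chi n))\<^sup>2) \<le> (\<Sum>n\<in>{1..int M}. 1)"
        by (intro sum_mono power_le_one norm_truncate_mod_le assms) auto
      then show ?thesis using M by (simp add: zmod_avg_def)
    qed
    finally show "(\<Sum>\<xi>\<in>{1..int M}. (norm (c \<xi>))\<^sup>2) \<le> 1" .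
  qed (use assms in auto)
  ultimately show ?thesis by simp
qed

section \<open>The prime modulus and the chain of parameters\<close>

lemma N_tilde: "prime (N_tilde l N)" "10 * l * N < N_tilde l N"
proof -
  obtain p where "prime p \<and> 10 * l * N < p" using bigger_prime by blast
  then show "prime (N_tilde l N)" "10 * l * N < N_tilde l N"
    unfolding N_tilde_def by (rule LeastI2; simp)+
qed

lemma exists_inverse_mod_prime:
  fixes Q M :: nat
  assumes "prime M" "0 < Q" "Q < M"
  obtains s where "int M dvd s * int Q - 1"
proof -
  have "coprime (int Q) (int M)"
    using assms by (metis coprime_commute coprime_int_iff nat_dvd_not_less prime_imp_coprime)
  then obtain s where "[int Q * s = 1] (mod int M)" using cong_solve_coprime_int by blast
  then show ?thesis by (intro that[of s]) (simp add: cong_iff_dvd_diff mult.commute)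
qed

text \<open>Level \<open>k\<close> serves the precision \<open>1 / Suc k\<close>. Products of the
  individual periods give divisibility, and \<open>m k / Q k\<close> is a partial sum, hence
  increasing; this is what monotonicity of the Fejer coefficients requires. The last clause supplies
  \<open>major\<close> for the \<open>U\<^sup>2\<close> bound.\<close>

lemma compatible_levels:
  obtains Q m N0 :: "nat \<Rightarrow> nat" where
    "\<And>k. 0 < Q k" "\<And>k. Q k \<le> m k"
    "\<And>k k'. k \<le> k' \<Longrightarrow> \<exists>t. Q k' = t * Q k \<and> t * m k \<le> m k'"
    "\<And>k N chi z. N0 k \<le> N \<Longrightarrow> chi \<in> unimodular_cmult \<Longrightarrow> norm z = 1 \<Longrightarrow>
       (1 / Suc k)\<^sup>2 * N \<le> norm (\<Sum>n\<in>{1..N}. chi n * z ^ n) \<Longrightarrow>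
       norm (1 - z ^ Q k) * N \<le> (1 / Suc k) ^ 4 * m k"
proof -
  define \<delta> where "\<delta> k = 1 / real (Suc k)" for k
  have \<delta>: "\<delta> k > 0" for k by (simp add: \<delta>_def)
  define good where "good k q C N0 \<longleftrightarrow> 0 < q \<and> (\<forall>N\<ge>N0. \<forall>chi\<in>unimodular_cmult. \<forall>z. norm z = 1 \<longrightarrow>
      (\<delta> k)\<^sup>2 * N \<le> norm (\<Sum>n\<in>{1..N}. chi n * z ^ n) \<longrightarrow> norm (1 - z ^ q) * N \<le> C)"
    for k q :: nat and C :: real and N0 :: nat
  have "\<exists>q C N0. good k q C N0" for k
  proof -
    have "(\<delta> k)\<^sup>2 > 0" using \<delta>[of k] by simp
    then obtain q :: nat and C :: real and N0 :: nat where "0 < q"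
      and "\<And>N chi z. N \<ge> N0 \<Longrightarrow> chi \<in> unimodular_cmult \<Longrightarrow> norm z = 1 \<Longrightarrow>
        (\<delta> k)\<^sup>2 * N \<le> norm (\<Sum>n\<in>{1..N}. chi n * z ^ n) \<Longrightarrow> norm (1 - z ^ q) * N \<le> C"
      by (rule large_exponential_sum) blast
    then have "good k q C N0" unfolding good_def by blast
    then show ?thesis by blast
  qed
  then obtain q C N0 where good: "\<And>k. good k (q k) (C k) (N0 k)" by metis
  have q: "0 < q k" for k using good unfolding good_def by blast
  have major: "norm (1 - z ^ q k) * N \<le> C k"
    if "N0 k \<le> N" "chi \<in> unimodular_cmult" "norm z = 1"
      "(\<delta> k)\<^sup>2 * N \<le> norm (\<Sum>n\<in>{1..N}. chi n * z ^ n)" for k N chi z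
    using good[of k] that unfolding good_def by blast
  \<comment> \<open>Large enough for \<open>C k \<le> \<delta> k ^ 4 * b k\<close>; the
    \<open>Suc\<close> makes it positive, which gives \<open>Q k \<le> m k\<close>.\<close>
  define b where "b k = Suc (nat \<lceil>C k / \<delta> k ^ 4\<rceil>)" for k
  define c where "c k = (\<Sum>j\<le>k. b j)" for k
  define Q where "Q k = (\<Prod>j\<le>k. q j)" for k
  have b: "C k \<le> \<delta> k ^ 4 * b k" for k
  proof -
    have "C k / \<delta> k ^ 4 \<le> b k" unfolding b_def by linarith
    then show ?thesis using \<delta>[of k] by (simp add: field_simps)
  qed
  have bc: "b k \<le> c k" for k unfolding c_def by (rule member_le_sum) auto
  show ?thesis
  proof (rule that[of Q "\<lambda>k. Q k * c k" N0])
    show "0 < Q k" for k by (simp add: Q_def q prod_pos)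
    have "1 \<le> c k" for k using bc[of k] by (simp add: b_def)
    then show "Q k \<le> Q k * c k" for k by simp
    show "\<exists>t. Q k' = t * Q k \<and> t * (Q k * c k) \<le> Q k' * c k'" if "k \<le> k'" for k k'
    proof -
      have "Q k dvd Q k'" unfolding Q_def using that by (intro prod_dvd_prod_subset) auto
      then obtain t where t: "Q k' = t * Q k" by (metis dvdE mult.commute)
      have "c k \<le> c k'" unfolding c_def using that by (intro sum_mono2) auto
      then show ?thesis using t by (intro exI[of _ t]) (simp flip: mult.assoc)
    qed
    fix k N chi z
    assume *: "N0 k \<le> N" "chi \<in> unimodular_cmult" "norm (z :: complex) = 1"
      "(1 / Suc k)\<^sup>2 * N \<le> norm (\<Sum>n\<in>{1..N}. chi n * z ^ n)"
    have "q k dvd Q k" unfolding Q_def by (rule dvd_prodI) auto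
    then obtain t where t: "Q k = q k * t" by (elim dvdE)
    then have tQ: "t \<le> Q k" using q[of k] by simp
    have "norm (1 - z ^ Q k) \<le> t * norm (1 - z ^ q k)"
      using norm_power_diff[of 1 "z ^ q k" t] *(3) by (simp add: t power_mult norm_power)
    then have "norm (1 - z ^ Q k) * N \<le> t * norm (1 - z ^ q k) * N" by (intro mult_right_mono) auto
    also have "\<dots> \<le> t * (\<delta> k ^ 4 * b k)"
      using major[OF *(1-3)] *(4) b[of k] unfolding mult.assoc \<delta>_def by (intro mult_left_mono) auto
    \<comment> \<open>The factor \<open>Q k\<close> in \<open>m k\<close> absorbs the loss
      \<open>t\<close> of passing from the period \<open>q k\<close> to its multiple
      \<open>Q k\<close>.\<close>
    also have "\<dots> \<le> Q k * (\<delta> k ^ 4 * c k)"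
      using tQ bc[of k] \<delta>[of k] by (intro mult_mono) auto
    finally show "norm (1 - z ^ Q k) * N \<le> (1 / Suc k) ^ 4 * (Q k * c k)" by (simp add: \<delta>_def mult_ac)
  qed
qed

theorem theorem3p2:
  fixes l1 l2 l3 l :: nat
  assumes "l1 > 0" and "l2 > 0" and "l3 > 0" and "l = l1 + l2 + l3"
  shows "\<exists>(Q :: real \<Rightarrow> nat) (R :: real \<Rightarrow> nat) (N0 :: real \<Rightarrow> nat) (\<phi> :: nat \<Rightarrow> real \<Rightarrow> int \<Rightarrow> real).
    (\<forall>\<theta>>0. Q \<theta> > 0 \<and> R \<theta> > 0 \<and> N0 \<theta> > 0 \<and>
      (\<forall>N\<ge>N0 \<theta>. zmod_kernel (N_tilde l N) (\<phi> N \<theta>) \<and>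
        (\<forall>chi\<in>unimodular_cmult.
          (\<forall>n::int. cmod (structured_part (N_tilde l N) N (\<phi> N \<theta>) chi (n + int (Q \<theta>))
                         - structured_part (N_tilde l N) N (\<phi> N \<theta>) chi n)
                    \<le> real (R \<theta>) / real (N_tilde l N)) \<and>
          U2_norm (N_tilde l N) (uniform_part (N_tilde l N) N (\<phi> N \<theta>) chi) \<le> \<theta>))) \<and>
    (\<forall>\<theta> \<theta>'. 0 < \<theta>' \<and> \<theta>' \<le> \<theta> \<longrightarrow>
      (\<forall>N. N \<ge> N0 \<theta> \<and> N \<ge> N0 \<theta>' \<longrightarrow>
        (\<forall>\<xi>::int.
          zmod_fourier (N_tilde l N) (\<lambda>n. complex_of_real (\<phi> N \<theta>' n)) \<xi>
            \<ge> zmod_fourier (N_tilde l N) (\<lambda>n. complex_of_real (\<phi> N \<theta> n)) \<xi> \<and>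
          zmod_fourier (N_tilde l N) (\<lambda>n. complex_of_real (\<phi> N \<theta> n)) \<xi> \<ge> 0)))"
proof -
  obtain Q m N0 :: "nat \<Rightarrow> nat" where Q: "\<And>k. 0 < Q k" and Qm: "\<And>k. Q k \<le> m k"
    and chain: "\<And>k k'. k \<le> k' \<Longrightarrow> \<exists>t. Q k' = t * Q k \<and> t * m k \<le> m k'"
    and major: "\<And>k N chi z. N0 k \<le> N \<Longrightarrow> chi \<in> unimodular_cmult \<Longrightarrow> norm z = 1 \<Longrightarrow>
       (1 / Suc k)\<^sup>2 * N \<le> norm (\<Sum>n\<in>{1..N}. chi n * z ^ n) \<Longrightarrow>
       norm (1 - z ^ Q k) * N \<le> (1 / Suc k) ^ 4 * m k"
    using compatible_levels by blast
  \<comment> \<open>All choices depend on \<open>\<theta>\<close> only through this level, which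
    grows as \<open>\<theta>\<close> shrinks.\<close>
  define lev where "lev \<theta> = nat \<lceil>1 / \<theta>\<rceil>" for \<theta> :: real
  define M where "M N = N_tilde l N" for N
  define s where "s N k = (SOME s. int (M N) dvd s * int (Q k) - 1)" for N k
  \<comment> \<open>The summand \<open>2 * m k\<close> ensures \<open>2 * m k \<le> M N\<close>, so
    the Fejer formula applies, and \<open>Q k < M N\<close>, so \<open>Q k\<close> is invertible
    modulo the prime.\<close>
  define N1 where "N1 k = N0 k + 2 * m k" for k
  define \<phi> where "\<phi> N \<theta> = fejer (M N) (m (lev \<theta>)) (s N (lev \<theta>))" for N \<theta>
  have m: "0 < m k" for k using Q[of k] Qm[of k] by linarith
  have NM: "N < M N" if "0 < N" for N
  proof -
    have "1 * N \<le> 10 * l * N" using assms by (intro mult_right_mono) auto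
    also have "\<dots> < M N" unfolding M_def by (rule N_tilde)
    finally show ?thesis by simp
  qed
  have large: "N < M N" "2 * m k \<le> M N" "0 < M N" "int (M N) dvd s N k * int (Q k) - 1"
    if "N1 k \<le> N" for N k
  proof -
    have N: "2 * m k \<le> N" using that by (simp add: N1_def)
    then show *: "N < M N" using NM[of N] m[of k] by simp
    then show "2 * m k \<le> M N" "0 < M N" using N by simp_all
    have "Q k < M N" using * N Qm[of k] m[of k] by linarith
    then obtain t where "int (M N) dvd t * int (Q k) - 1"
      using exists_inverse_mod_prime[of "M N" "Q k"] N_tilde(1) Q unfolding M_def by blast
    then show "int (M N) dvd s N k * int (Q k) - 1" unfolding s_def by (rule someI)
  qed
  have lev_le: "1 / real (Suc (lev \<theta>)) \<le> \<theta>" if "\<theta> > 0" for \<theta>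
  proof -
    have "1 / \<theta> \<le> real (Suc (lev \<theta>))" unfolding lev_def by linarith
    then show ?thesis using that by (simp add: field_simps)
  qed
  have lev_mono: "lev \<theta> \<le> lev \<theta>'" if "0 < \<theta>'" "\<theta>' \<le> \<theta>" for \<theta> \<theta>'
    unfolding lev_def using that by (intro nat_mono ceiling_mono divide_left_mono) auto
  have fourier: "zmod_fourier (M N) (\<lambda>n. complex_of_real (\<phi> N \<theta> n)) \<xi> =
      of_real (fejer_coeff (M N) (m (lev \<theta>)) (int (Q (lev \<theta>)) * \<xi>))"
    if "N1 (lev \<theta>) \<le> N" for N \<theta> \<xi>
    unfolding \<phi>_def by (rule fourier_fejer[OF large(3,4)[OF that]])
  show ?thesis
    unfolding M_def[symmetric]
  \<comment> \<open>The witness for \<open>R\<close> is the numerator in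
    \<open>structured_part_almost_periodic\<close>.\<close>
  proof (rule exI[of _ "\<lambda>\<theta>. Q (lev \<theta>)"], rule exI[of _ "\<lambda>\<theta>. 7 * (m (lev \<theta>))\<^sup>2"],
      rule exI[of _ "\<lambda>\<theta>. N1 (lev \<theta>)"], rule exI[of _ \<phi>], intro conjI allI impI ballI)
    fix \<theta> :: real assume \<theta>: "\<theta> > 0"
    show "0 < Q (lev \<theta>)" by (rule Q)
    show "0 < 7 * (m (lev \<theta>))\<^sup>2" using m[of "lev \<theta>"] by simp
    show "0 < N1 (lev \<theta>)" using m[of "lev \<theta>"] by (simp add: N1_def)
    fix N assume N: "N1 (lev \<theta>) \<le> N"
    note large = large[OF N]
    show "zmod_kernel (M N) (\<phi> N \<theta>)"
      unfolding \<phi>_def by (rule zmod_kernel_fejer[OF large(3) m large(2,4)])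
    fix chi assume chi: "chi \<in> unimodular_cmult"
    show "cmod (structured_part (M N) N (\<phi> N \<theta>) chi (n + int (Q (lev \<theta>)))
        - structured_part (M N) N (\<phi> N \<theta>) chi n) \<le> real (7 * (m (lev \<theta>))\<^sup>2) / real (M N)" for n
      using structured_part_almost_periodic[OF large(1) m large(2,4) chi] by (simp add: \<phi>_def)
    have "U2_norm (M N) (uniform_part (M N) N (\<phi> N \<theta>) chi) \<le> 1 / Suc (lev \<theta>)"
      unfolding \<phi>_def
    proof (rule U2_norm_uniform_part_le[OF large(1) m large(2,4) chi])
      fix z :: complex
      assume "norm z = 1" "(1 / real (Suc (lev \<theta>)))\<^sup>2 * N \<le> norm (\<Sum>n\<in>{1..N}. chi n * z ^ n)"
      then show "norm (1 - z ^ Q (lev \<theta>)) * N \<le> (1 / real (Suc (lev \<theta>))) ^ 4 * m (lev \<theta>)"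
        using N chi by (intro major) (auto simp: N1_def)
    qed simp
    then show "U2_norm (M N) (uniform_part (M N) N (\<phi> N \<theta>) chi) \<le> \<theta>" using lev_le[OF \<theta>] by linarith
  next
    fix \<theta> \<theta>' :: real and N :: nat and \<xi> :: int
    assume *: "0 < \<theta>' \<and> \<theta>' \<le> \<theta>" and N: "N1 (lev \<theta>) \<le> N \<and> N1 (lev \<theta>') \<le> N"
    obtain t where t: "Q (lev \<theta>') = t * Q (lev \<theta>)" "t * m (lev \<theta>) \<le> m (lev \<theta>')"
      using chain[OF lev_mono] * by blast
    \<comment> \<open>The right argument equals \<open>Q (lev \<theta>') * \<xi>\<close>, so the
      comparison of dilated widths applies.\<close>
    have "fejer_coeff (M N) (m (lev \<theta>)) (int (Q (lev \<theta>)) * \<xi>) \<le>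
        fejer_coeff (M N) (m (lev \<theta>')) (int t * (int (Q (lev \<theta>)) * \<xi>))"
      using N t(2) by (intro fejer_coeff_mult_le m large) auto
    \<comment> \<open>The order on complex numbers also demands equal imaginary parts; both
      coefficients are real.\<close>
    then show "zmod_fourier (M N) (\<lambda>n. complex_of_real (\<phi> N \<theta> n)) \<xi>
        \<le> zmod_fourier (M N) (\<lambda>n. complex_of_real (\<phi> N \<theta>' n)) \<xi>"
      using N by (simp add: fourier t(1) less_eq_complex_def mult.assoc)
  next
    fix \<theta> \<theta>' :: real and N :: nat and \<xi> :: int
    assume N: "N1 (lev \<theta>) \<le> N \<and> N1 (lev \<theta>') \<le> N"
    then show "0 \<le> zmod_fourier (M N) (\<lambda>n. complex_of_real (\<phi> N \<theta> n)) \<xi>"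
      by (simp add: fourier less_eq_complex_def fejer_coeff_nonneg)
  qed
qed

end
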